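(* Let $0<p<1$ and $0<s\le\infty$. Then $(H_0^{p,\infty},\ell^s)=\ell^s_{1/p-1}$.
   Context: $\mathbb{D}$ is the open unit disk, $\mathbb{T}$ its boundary, $m$ normalized Lebesgue measure on $\mathbb{T}$, $H(\mathbb{D})$ the analytic functions on $\mathbb{D}$. $W$ is the space of complex sequences indexed by $\mathbb{N}_0=\{0,1,2,\dots\}$; $f(z)=\sum a_nz^n\in H(\mathbb{D})$ is identified with $\{a_n\}\in W$. $\ell^s\subset W$ is the space of $s$-summable sequences ($s<\infty$) or bounded sequences ($s=\infty$). For vector subspaces $E,X$ of $W$, $(E,X)=\{\lambda\in W:\{\lambda_nw_n\}\in X\text{ for all }w\in E\}$. For real $\alpha$ let $w_\alpha(0)=1$, $w_\alpha(n)=n^\alpha$ for $n\ge1$, and $X_\alpha=\{y\in W:\{w_\alpha(n)y_n\}\in X\}$; $\ell^s_\alpha=(\ell^s)_\alpha$. $H^{p,\infty}_0$: for measurable $f$ on $\mathbb{T}$ let $\lambda_f(s)=m(\{|f|>s\})$, $f^*(s)=\inf\{t\ge0:\lambda_f(t)\le s\}$. The Smirnov class $N^+$ consists of $f\in H(\mathbb{D})$ in the Nevanlinna class with $\lim_{r\to1^-}\int_{\mathbb{T}}\log^+|f(rz)|\,dm=\int_{\mathbb{T}}\log^+|f|\,dm$, where $f$ on $\mathbb{T}$ is the nontangential boundary function. $H^{p,\infty}_0$ is the set of $f\in N^+$ whose boundary function satisfies $\sup_{s>0}f^*(s)s^{1/p}<\infty$ and $\lim_{s\to0}f^*(s)s^{1/p}=0$.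 *)

theory Defs
  imports "HOL-Complex_Analysis.Complex_Analysis" "HOL-Probability.Probability"
begin

section \<open>Sequence spaces and multipliers\<close>

definition ell :: "ennreal \<Rightarrow> (nat \<Rightarrow> complex) set" where
  "ell s = (if s = \<infinity> then {y. bounded (range y)}
            else {y. summable (\<lambda>n. cmod (y n) powr enn2real s)})"

definition multipliers ::
    "(nat \<Rightarrow> complex) set \<Rightarrow> (nat \<Rightarrow> complex) set \<Rightarrow> (nat \<Rightarrow> complex) set" where
  "multipliers E X = {l. \<forall>w\<in>E. (\<lambda>n. l n * w n) \<in> X}"

definition weight :: "real \<Rightarrow> nat \<Rightarrow> real" where
  "weight \<alpha> n = (if n = 0 then 1 else real n powr \<alpha>)"

definition weighted :: "(nat \<Rightarrow> complex) set \<Rightarrow> real \<Rightarrow> (nat \<Rightarrow> complex) set" where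
  "weighted X \<alpha> = {y. (\<lambda>n. of_real (weight \<alpha> n) * y n) \<in> X}"

section \<open>The circle and boundary functions\<close>

text \<open>The measure is completed, so that its measurable sets are the Lebesgue measurable
  subsets of the circle. Its underlying space is \<^term>\<open>sphere (0::complex) 1\<close>.\<close>

definition circle_measure :: "complex measure" where
  "circle_measure = completion
     (distr (uniform_measure lborel {0..2 * pi}) (restrict_space borel (sphere 0 1)) cis)"

definition stolz_region :: "real \<Rightarrow> complex \<Rightarrow> complex set" where
  "stolz_region c \<zeta> = {z \<in> ball 0 1. cmod (z - \<zeta>) < c * (1 - cmod z)}"

definition has_nt_limit :: "(complex \<Rightarrow> complex) \<Rightarrow> complex \<Rightarrow> complex \<Rightarrow> bool" where
  "has_nt_limit f \<zeta> L \<longleftrightarrow> (\<forall>c>1. (f \<longlongrightarrow> L) (at \<zeta> within stolz_region c \<zeta>))"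

text \<open>The value 0 where there is no nontangential limit is only a convention: by Fatou's theorem
  a function in the Nevanlinna class has a nontangential limit almost everywhere.\<close>

definition nt_boundary :: "(complex \<Rightarrow> complex) \<Rightarrow> complex \<Rightarrow> complex" where
  "nt_boundary f \<zeta> =
     (if \<exists>L. has_nt_limit f \<zeta> L then (THE L. has_nt_limit f \<zeta> L) else 0)"

section \<open>The Nevanlinna and Smirnov classes\<close>

text \<open>Since \<^term>\<open>ln (0::real) = 0\<close>, this gives the usual value 0 at 0.\<close>

definition log_plus :: "real \<Rightarrow> real" where
  "log_plus x = max 0 (ln x)"

definition log_mean :: "(complex \<Rightarrow> complex) \<Rightarrow> ennreal" where
  "log_mean g = (\<integral>\<^sup>+ \<zeta>. ennreal (log_plus (cmod (g \<zeta>))) \<partial>circle_measure)"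

definition nevanlinna_class :: "(complex \<Rightarrow> complex) set" where
  "nevanlinna_class = {f. f holomorphic_on ball 0 1 \<and>
     (SUP r\<in>{0<..<1}. log_mean (\<lambda>\<zeta>. f (of_real r * \<zeta>))) < \<infinity>}"

definition smirnov_class :: "(complex \<Rightarrow> complex) set" where
  "smirnov_class = {f \<in> nevanlinna_class.
     ((\<lambda>r. log_mean (\<lambda>\<zeta>. f (of_real r * \<zeta>))) \<longlongrightarrow> log_mean (nt_boundary f)) (at_left 1)}"

section \<open>Weak Hardy spaces\<close>

definition distribution_fn :: "(complex \<Rightarrow> complex) \<Rightarrow> real \<Rightarrow> real" where
  "distribution_fn g t = measure circle_measure {\<zeta> \<in> sphere 0 1. cmod (g \<zeta>) > t}"

text \<open>For measurable \<open>g\<close> and \<open>s > 0\<close> the set is nonempty, so the real infimum is the intended one;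
  only \<open>s > 0\<close> is used below.\<close>

definition rearrangement :: "(complex \<Rightarrow> complex) \<Rightarrow> real \<Rightarrow> real" where
  "rearrangement g s = Inf {t. t \<ge> 0 \<and> distribution_fn g t \<le> s}"

definition weak_hardy0 :: "real \<Rightarrow> (complex \<Rightarrow> complex) set" where
  "weak_hardy0 p = {f \<in> smirnov_class.
     bdd_above ((\<lambda>s. rearrangement (nt_boundary f) s * s powr (1 / p)) ` {0<..}) \<and>
     ((\<lambda>s. rearrangement (nt_boundary f) s * s powr (1 / p)) \<longlongrightarrow> 0) (at_right 0)}"

text \<open>Identification of analytic functions on the disk with their Taylor coefficients at 0.\<close>

definition coeff_seqs :: "(complex \<Rightarrow> complex) set \<Rightarrow> (nat \<Rightarrow> complex) set" where
  "coeff_seqs F = {a. \<exists>f\<in>F. \<forall>z\<in>ball 0 1. (\<lambda>n. a n * z ^ n) sums f z}"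

end

theory Submission
  imports Defs "HOL-Real_Asymp.Real_Asymp"
begin

text \<open>
  Both inclusions rest on the same scale: the coefficients of a function in the space are
  \<open>O(n\<^sup>\<alpha>)\<close> with \<open>\<alpha> = 1/p - 1\<close>, and, up to a factor tending to zero as slowly as desired, this
  order is attained at all \<open>n\<close> simultaneously.

  Upper bound. For \<open>f\<close> in the Smirnov class, \<open>log\<^sup>+ |f(z)|\<close> is at most the Poisson integral of
  \<open>log\<^sup>+\<close> of the boundary function (\<open>smirnov_log_plus_le_poisson\<close>). On smaller circles this is the
  subharmonicity of \<open>log\<^sup>+ |f|\<close>; the passage to the unit circle needs only Fatou's lemma, because
  convergence of the integrals is what the definition of the class provides. By Jensen's inequality
  \<open>|f|\<^sup>q\<close>, \<open>q = p/2\<close>, is dominated by the Poisson integral \<open>G\<close> of a weak \<open>L\<^sup>2\<close> function. Cutting that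
  function at a height \<open>t\<close> bounds \<open>G\<close> on the circle of radius \<open>r\<close> pointwise by a multiple of
  \<open>(1-r)\<close> to the power \<open>-1/2\<close> and shows that \<open>G\<close> is weak \<open>L\<^sup>2\<close> there, uniformly in \<open>r\<close>
  (\<open>weak_L2_poisson_majorant_bounds\<close>). Integrating the distribution function up to the pointwise
  bound gives a mean of \<open>|f|\<close> of order \<open>(1-r)\<close> to the power \<open>1 - 1/p\<close>
  (\<open>smirnov_weak_Lp_mean_growth\<close>); here \<open>p < 1\<close> makes the integral converge at the lower end. The
  Cauchy estimate at \<open>1 - r = 1/(2n)\<close> then bounds the coefficients.

  Lower bound. The function \<open>(1 - z)\<close> to the power \<open>-1/p\<close> has coefficients comparable to \<open>n\<^sup>\<alpha>\<close>,
  but it just fails the little-o condition at \<open>1\<close>. The superposition \<open>spread_kernel\<close> of its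
  dilates \<open>(1 - r\<^sub>k z)\<close> to the power \<open>-1/p\<close> with weights \<open>2\<close> to the power \<open>-k-1\<close> satisfies it: its
  product with \<open>|1 - z|\<close> to the power \<open>1/p\<close> extends continuously to the closed disk with the value
  \<open>0\<close> at \<open>1\<close> (\<open>weak_hardy0I\<close>). Its coefficients are still at least a constant times
  \<open>2\<close> to the power \<open>-k\<close> times \<open>n\<^sup>\<alpha>\<close> for \<open>n \<le> N\<^sub>k\<close>, where the \<open>N\<^sub>k\<close> are arbitrary
  (\<open>weak_hardy0_prescribed_coeffs\<close>). If a multiplier \<open>\<lambda>\<close> did not satisfy the weighted
  condition, then choosing the \<open>N\<^sub>k\<close> large enough would make the product with this sequence leave
  \<open>\<ell>\<^sup>s\<close>.
\<close>

section \<open>Normalized Lebesgue measure on the circle\<close>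

definition borel_circle :: "complex measure" where
  "borel_circle = distr (uniform_measure lborel {0..2 * pi}) (restrict_space borel (sphere 0 1)) cis"

lemma circle_measure_eq_completion: "circle_measure = completion borel_circle"
  by (simp add: circle_measure_def borel_circle_def)

lemma space_circle_measure [simp]: "space circle_measure = sphere 0 1"
  by (simp add: circle_measure_def space_restrict_space)

lemma sets_borel_circle: "sets borel_circle = sets (restrict_space borel (sphere 0 1))"
  by (simp add: borel_circle_def)

lemma cis_measurable_circle [measurable]:
  "cis \<in> measurable (uniform_measure lborel {0..2 * pi}) (restrict_space borel (sphere 0 1))"
proof (rule measurable_restrict_space2)
  have "cis \<in> borel_measurable borel"
    by (intro borel_measurable_continuous_onI continuous_on_cis continuous_on_id)
  then show "cis \<in> borel_measurable (uniform_measure lborel {0..2 * pi})"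
    by (simp cong: measurable_cong_sets)
qed auto

lemma prob_space_borel_circle: "prob_space borel_circle"
proof -
  interpret U: prob_space "uniform_measure lborel {0..2 * pi}"
    by (rule prob_space_uniform_measure) auto
  show ?thesis
    unfolding borel_circle_def by (rule U.prob_space_distr) (rule cis_measurable_circle)
qed

lemma prob_space_circle_measure: "prob_space circle_measure"
  by (simp add: circle_measure_eq_completion prob_space.prob_space_completion prob_space_borel_circle)

interpretation circle: prob_space circle_measure
  by (rule prob_space_circle_measure)

lemma borel_measurable_circleI:
  "f \<in> borel_measurable (restrict_space borel (sphere 0 1)) \<Longrightarrow> f \<in> borel_measurable circle_measure"
  unfolding circle_measure_eq_completion
  by (rule measurable_completion) (simp add: borel_circle_def cong: measurable_cong_sets)

lemma continuous_on_measurable_circle: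
  fixes f :: "complex \<Rightarrow> 'a::topological_space"
  shows "continuous_on (sphere 0 1) f \<Longrightarrow> f \<in> borel_measurable circle_measure"
  by (intro borel_measurable_circleI borel_measurable_continuous_on_restrict)

lemma borel_sets_circle:
  assumes "A \<in> sets borel" "A \<subseteq> sphere 0 1"
  shows "A \<in> sets circle_measure"
proof -
  have "A \<in> sets borel_circle"
    using assms by (auto simp: sets_borel_circle sets_restrict_space)
  then show ?thesis
    by (simp add: circle_measure_eq_completion)
qed

lemma continuous_on_integrable_circle:
  fixes f :: "complex \<Rightarrow> 'a::{banach, second_countable_topology}"
  assumes "continuous_on (sphere 0 1) f"
  shows "integrable circle_measure f"
proof -
  have "compact (f ` sphere 0 1)"
    using assms compact_continuous_image compact_sphere by blast
  then obtain B where "\<forall>x\<in>sphere 0 1. norm (f x) \<le> B"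
    by (metis bounded_iff compact_imp_bounded image_eqI)
  then show ?thesis
    by (intro circle.integrable_const_bound[where B = B] continuous_on_measurable_circle assms) auto
qed

lemma integral_circle_eq:
  fixes f :: "complex \<Rightarrow> 'a::{banach, second_countable_topology}"
  assumes f: "continuous_on (sphere 0 1) f"
  shows "integral\<^sup>L circle_measure f = (1 / (2 * pi)) *\<^sub>R (LINT t:{0..2 * pi}|lborel. f (cis t))"
proof -
  have fm: "f \<in> borel_measurable (restrict_space borel (sphere 0 1))"
    using f by (rule borel_measurable_continuous_on_restrict)
  have fm': "f \<in> borel_measurable borel_circle"
    using fm by (simp add: borel_circle_def cong: measurable_cong_sets)
  have fc: "continuous_on UNIV (\<lambda>t. f (cis t))"
    by (rule continuous_on_compose2[OF f]) (auto intro: continuous_intros simp: continuous_on_cis)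
  then have fcm: "(\<lambda>t. f (cis t)) \<in> borel_measurable borel"
    by (rule borel_measurable_continuous_onI)
  have "integral\<^sup>L circle_measure f = integral\<^sup>L borel_circle f"
    unfolding circle_measure_eq_completion by (rule integral_completion[OF fm'])
  also have "\<dots> = integral\<^sup>L (uniform_measure lborel {0..2 * pi}) (\<lambda>t. f (cis t))"
    unfolding borel_circle_def by (rule integral_distr[OF cis_measurable_circle fm])
  also have "uniform_measure lborel {0..2 * pi} =
      density lborel (\<lambda>t. ennreal (indicator {0..2 * pi} t / (2 * pi)))"
    unfolding uniform_measure_def
    by (intro density_cong) (auto simp: divide_ennreal[symmetric] indicator_def)
  also have "integral\<^sup>L \<dots> (\<lambda>t. f (cis t)) =
      (\<integral>t. (indicator {0..2 * pi} t / (2 * pi)) *\<^sub>R f (cis t) \<partial>lborel)"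
    using fcm by (intro integral_density) auto
  also have "\<dots> = (\<integral>t. (1 / (2 * pi)) *\<^sub>R (indicator {0..2 * pi} t *\<^sub>R f (cis t)) \<partial>lborel)"
    by (intro Bochner_Integration.integral_cong) auto
  also have "\<dots> = (1 / (2 * pi)) *\<^sub>R (LINT t:{0..2 * pi}|lborel. f (cis t))"
    unfolding set_lebesgue_integral_def by (rule integral_scaleR_right)
  finally show ?thesis .
qed

text \<open>On the circle \<open>dw = \<i> w dt\<close>, so means over the circle are Cauchy integrals.\<close>

lemma contour_integral_circle_eq:
  fixes f :: "complex \<Rightarrow> complex"
  assumes f: "continuous_on (sphere 0 1) f"
  shows "contour_integral (circlepath 0 1) (\<lambda>w. f w / w) = 2 * pi * \<i> * integral\<^sup>L circle_measure f"
proof -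
  have fc: "continuous_on {0..2 * pi} (\<lambda>t. f (cis t))"
    by (rule continuous_on_compose2[OF f]) (auto intro: continuous_intros simp: continuous_on_cis)
  have "contour_integral (circlepath 0 1) (\<lambda>w. f w / w) = integral {0..2 * pi} (\<lambda>t. \<i> * f (cis t))"
    unfolding circlepath_def
    by (subst contour_integral_part_circlepath_eq) (auto simp: mult.commute intro!: integral_cong)
  also have "\<dots> = \<i> * integral {0..2 * pi} (\<lambda>t. f (cis t))"
    by simp
  also have "integral {0..2 * pi} (\<lambda>t. f (cis t)) = (LINT t:{0..2 * pi}|lborel. f (cis t))"
    using fc by (intro set_borel_integral_eq_integral(2)[symmetric])
      (auto simp: set_integrable_def intro!: borel_integrable_compact)
  also have "\<dots> = of_real (2 * pi) * integral\<^sup>L circle_measure f"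
    by (simp add: integral_circle_eq[OF f] scaleR_conv_of_real)
  finally show ?thesis
    by (simp add: mult_ac)
qed

text \<open>By concavity the sine lies above its chord on \<open>[0, \<pi>/2]\<close>.\<close>

lemma sin_ge_chord:
  fixes x :: real
  assumes "0 \<le> x" "x \<le> pi / 2"
  shows "2 * x / pi \<le> sin x"
proof -
  have "concave_on {0..pi/2} sin"
  proof (rule f''_le0_imp_concave)
    show "(sin has_real_derivative cos x) (at x)" for x :: real by (rule DERIV_sin)
    show "(cos has_real_derivative - sin x) (at x)" for x :: real by (rule DERIV_cos)
    show "- sin x \<le> 0" if "x \<in> {0..pi/2}" for x
      using that sin_ge_zero[of x] by auto
  qed auto
  then have "sin ((1 - 2 * x / pi) *\<^sub>R 0 + (2 * x / pi) *\<^sub>R (pi / 2)) \<ge> (1 - 2 * x / pi) * sin 0 + (2 * x / pi) * sin (pi / 2)"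
    using assms by (intro concave_onD) (auto simp: field_simps)
  then show ?thesis by simp
qed

lemma cmod_one_minus_cis: 
  assumes "0 \<le> t" "t \<le> 2 * pi"
  shows "cmod (1 - cis t) = 2 * sin (t / 2)"
proof -
  have "(cmod (1 - cis t))\<^sup>2 = (1 - cos t)\<^sup>2 + (sin t)\<^sup>2"
    by (simp add: cmod_power2)
  also have "\<dots> = 2 - 2 * cos t"
    using sin_cos_squared_add[of t] by (simp add: power2_eq_square algebra_simps)
  also have "\<dots> = (2 * sin (t / 2))\<^sup>2"
    using cos_double_sin[of "t / 2"] by (simp add: power2_eq_square)
  finally show ?thesis
    using assms sin_ge_zero[of "t / 2"] by (auto intro: power2_eq_imp_eq[of _ "2 * sin (t / 2)"])
qed

text \<open>Since \<open>|1 - e\<^sup>i\<^sup>t| = 2 sin (t/2)\<close>, the chord bound for the sine confines \<open>t\<close> to two intervals at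
  the ends of \<open>[0, 2\<pi>]\<close>, each of length \<open>\<pi>\<rho>/2\<close>.\<close>

lemma measure_circle_near_one:
  assumes "\<rho> \<ge> 0"
  shows "measure circle_measure {\<zeta> \<in> sphere 0 1. cmod (1 - \<zeta>) < \<rho>} \<le> \<rho>"
proof -
  let ?A = "{\<zeta> \<in> sphere 0 1. cmod (1 - \<zeta>) < \<rho>}"
  have A: "?A \<in> sets (restrict_space borel (sphere 0 1))"
    unfolding sets_restrict_space
    by (rule image_eqI[where x = "{\<zeta>. cmod (1 - \<zeta>) < \<rho>}"]) auto
  have preA: "cis -` ?A \<inter> space lborel = {t. cmod (1 - cis t) < \<rho>}" by auto
  have Am: "{t. cmod (1 - cis t) < \<rho>} \<in> sets lborel"
  proof -
    have "open {t. cmod (1 - cis t) < \<rho>}"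
      by (intro open_Collect_less continuous_intros continuous_on_cis)
    then show ?thesis by simp
  qed
  have sub: "{0..2 * pi} \<inter> {t. cmod (1 - cis t) < \<rho>} \<subseteq> {0..pi * \<rho> / 2} \<union> {2 * pi - pi * \<rho> / 2..2 * pi}"
  proof
    fix t assume "t \<in> {0..2 * pi} \<inter> {t. cmod (1 - cis t) < \<rho>}"
    then have t: "0 \<le> t" "t \<le> 2 * pi" "cmod (1 - cis t) < \<rho>" by auto
    have bound: "pi * (2 * sin (t / 2)) \<le> pi * \<rho>"
      using t cmod_one_minus_cis[of t] by (intro mult_left_mono) auto
    show "t \<in> {0..pi * \<rho> / 2} \<union> {2 * pi - pi * \<rho> / 2..2 * pi}"
    proof (cases "t \<le> pi")
      case True
      then have "2 * (t / 2) / pi \<le> sin (t / 2)"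
        using t by (intro sin_ge_chord) auto
      then have "t \<le> pi * sin (t / 2)"
        by (simp add: field_simps)
      then have "t \<le> pi * \<rho> / 2"
        using bound by linarith
      then show ?thesis
        using t by simp
    next
      case False
      then have "2 * (pi - t / 2) / pi \<le> sin (pi - t / 2)"
        using t by (intro sin_ge_chord) auto
      also have "sin (pi - t / 2) = sin (t / 2)" by (rule sin_pi_minus)
      finally have "2 * pi - t \<le> pi * sin (t / 2)"
        by (simp add: field_simps)
      then have "2 * pi - pi * \<rho> / 2 \<le> t"
        using bound by linarith
      then show ?thesis
        using t by simp
    qed
  qed
  have "emeasure circle_measure ?A = emeasure borel_circle ?A"
  proof -
    have "?A \<in> sets borel_circle"
      using A by (simp only: sets_borel_circle)
    then show ?thesis
      by (simp add: circle_measure_eq_completion main_part_sets)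
  qed
  also have "\<dots> = emeasure (uniform_measure lborel {0..2 * pi}) {t. cmod (1 - cis t) < \<rho>}"
  proof -
    have "cis -` ?A \<inter> space (uniform_measure lborel {0..2 * pi}) = {t. cmod (1 - cis t) < \<rho>}"
      by (auto simp only: space_uniform_measure preA[symmetric])
    then show ?thesis
      unfolding borel_circle_def by (simp only: emeasure_distr[OF cis_measurable_circle A])
  qed
  also have "\<dots> = emeasure lborel ({0..2 * pi} \<inter> {t. cmod (1 - cis t) < \<rho>}) / ennreal (2 * pi)"
  proof -
    have "emeasure lborel {0..2 * pi} = ennreal (2 * pi)"
      by simp
    then show ?thesis
      using Am by (simp only: emeasure_uniform_measure[OF _ Am] atLeastAtMost_borel sets_lborel)
  qed
  also have "\<dots> \<le> emeasure lborel ({0..pi * \<rho> / 2} \<union> {2 * pi - pi * \<rho> / 2..2 * pi}) / ennreal (2 * pi)"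
    using sub by (intro divide_right_mono_ennreal emeasure_mono) auto
  also have "\<dots> \<le> (ennreal (pi * \<rho> / 2) + ennreal (pi * \<rho> / 2)) / ennreal (2 * pi)"
    using assms by (intro divide_right_mono_ennreal order.trans[OF emeasure_subadditive]) auto
  also have "\<dots> = ennreal (\<rho> / 2)"
    using assms by (simp add: ennreal_plus[symmetric] divide_ennreal del: ennreal_plus)
  also have "\<dots> \<le> ennreal \<rho>"
    using assms by (intro ennreal_leI) auto
  finally show ?thesis
    using assms by (simp add: circle.emeasure_eq_measure)
qed

section \<open>Distribution functions and truncated means\<close>

text \<open>Tonelli's theorem for the region under the graph of \<open>h\<close>. The density \<open>k\<close> is kept general because
  it is used both as the indicator of a half-line and as the derivative of a power.\<close>

lemma nn_integral_layer_cake: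
  fixes h k :: "_ \<Rightarrow> real"
  assumes M: "sigma_finite_measure M"
    and [measurable]: "h \<in> borel_measurable M" "k \<in> borel_measurable borel"
  shows "(\<integral>\<^sup>+x. (\<integral>\<^sup>+t. ennreal (k t) * indicator {0<..<h x} t \<partial>lborel) \<partial>M) =
    (\<integral>\<^sup>+t. ennreal (k t) * indicator {0<..} t * emeasure M {x \<in> space M. t < h x} \<partial>lborel)"
proof -
  interpret M: sigma_finite_measure M by fact
  interpret pair_sigma_finite M lborel
    by (simp add: pair_sigma_finite_def M lborel.sigma_finite_measure_axioms)
  have "(\<integral>\<^sup>+x. (\<integral>\<^sup>+t. ennreal (k t) * indicator {0<..<h x} t \<partial>lborel) \<partial>M) =
      (\<integral>\<^sup>+x. (\<integral>\<^sup>+t. ennreal (k t) * indicator {0<..} t * (if t < h x then 1 else 0) \<partial>lborel) \<partial>M)"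
    by (intro nn_integral_cong) (auto split: split_indicator)
  also have "\<dots> = (\<integral>\<^sup>+t. (\<integral>\<^sup>+x. ennreal (k t) * indicator {0<..} t * (if t < h x then 1 else 0) \<partial>M) \<partial>lborel)"
    by (rule Fubini'[symmetric]) measurable
  also have "\<dots> = (\<integral>\<^sup>+t. ennreal (k t) * indicator {0<..} t * emeasure M {x \<in> space M. t < h x} \<partial>lborel)"
  proof (intro nn_integral_cong)
    fix t :: real
    have "(\<integral>\<^sup>+x. ennreal (k t) * indicator {0<..} t * (if t < h x then 1 else 0) \<partial>M) =
        ennreal (k t) * indicator {0<..} t * (\<integral>\<^sup>+x. (if t < h x then 1 else 0) \<partial>M)"
      by (rule nn_integral_cmult) measurable
    also have "(\<integral>\<^sup>+x. (if t < h x then 1 else 0) \<partial>M) = (\<integral>\<^sup>+x. indicator {x \<in> space M. t < h x} x \<partial>M)"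
      by (intro nn_integral_cong) (auto split: split_indicator)
    also have "\<dots> = emeasure M {x \<in> space M. t < h x}"
      by (rule nn_integral_indicator) measurable
    finally show "(\<integral>\<^sup>+x. ennreal (k t) * indicator {0<..} t * (if t < h x then 1 else 0) \<partial>M) =
      ennreal (k t) * indicator {0<..} t * emeasure M {x \<in> space M. t < h x}" .
  qed
  finally show ?thesis .
qed

text \<open>The excess over \<open>\<tau>\<close> is the integral of the distribution function over \<open>(\<tau>, \<infinity>)\<close>, and
  \<open>C / \<tau>\<close> is the corresponding integral of \<open>C / t\<^sup>2\<close>.\<close>

lemma nn_integral_excess_weak_L2:
  fixes h :: "_ \<Rightarrow> real"
  assumes M: "sigma_finite_measure M"
    and [measurable]: "h \<in> borel_measurable M"
    and weak: "\<And>t. t > \<tau> \<Longrightarrow> emeasure M {x \<in> space M. t < h x} \<le> ennreal (C / t\<^sup>2)"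
    and C: "C \<ge> 0" and \<tau>: "\<tau> > 0"
  shows "(\<integral>\<^sup>+x. ennreal (max 0 (h x - \<tau>)) \<partial>M) \<le> ennreal (C / \<tau>)"
proof -
  let ?k = "indicator {\<tau><..} :: real \<Rightarrow> real"
  have "(\<integral>\<^sup>+x. ennreal (max 0 (h x - \<tau>)) \<partial>M) =
      (\<integral>\<^sup>+x. (\<integral>\<^sup>+t. ennreal (?k t) * indicator {0<..<h x} t \<partial>lborel) \<partial>M)"
  proof (intro nn_integral_cong)
    fix x
    have "(\<integral>\<^sup>+t. ennreal (?k t) * indicator {0<..<h x} t \<partial>lborel) = (\<integral>\<^sup>+t. indicator {\<tau><..<h x} t \<partial>lborel)"
      using \<tau> by (intro nn_integral_cong) (auto split: split_indicator)
    also have "\<dots> = emeasure lborel {\<tau><..<h x}"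
      by (rule nn_integral_indicator) simp
    also have "\<dots> = ennreal (max 0 (h x - \<tau>))"
      by (cases "\<tau> \<le> h x") auto
    finally show "ennreal (max 0 (h x - \<tau>)) = (\<integral>\<^sup>+t. ennreal (?k t) * indicator {0<..<h x} t \<partial>lborel)" ..
  qed
  also have "\<dots> = (\<integral>\<^sup>+t. ennreal (?k t) * indicator {0<..} t * emeasure M {x \<in> space M. t < h x} \<partial>lborel)"
    by (intro nn_integral_layer_cake M) measurable
  also have "\<dots> \<le> (\<integral>\<^sup>+t. ennreal (C / t\<^sup>2) * indicator {\<tau>..} t \<partial>lborel)"
    using weak \<tau> by (intro nn_integral_mono) (auto split: split_indicator)
  also have "\<dots> = ennreal (0 - (- (C / \<tau>)))"
  proof (rule nn_integral_FTC_atLeast)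
    show "DERIV (\<lambda>t. - (C / t)) x :> C / x\<^sup>2" if "\<tau> \<le> x" for x
      using that \<tau> by (auto intro!: derivative_eq_intros simp: power2_eq_square)
    show "((\<lambda>t. - (C / t)) \<longlongrightarrow> 0) at_top"
      by real_asymp
  qed (use C \<tau> in auto)
  finally show ?thesis by simp
qed

lemma nn_integral_powr_Icc:
  fixes a c :: real
  assumes "a > -1" "c \<ge> 0" "K \<ge> 0"
  shows "(\<integral>\<^sup>+t. ennreal (K * t powr a) * indicator {0..c} t \<partial>lborel) = ennreal (K * (c powr (a + 1) / (a + 1)))"
proof -
  have "(\<integral>\<^sup>+t. ennreal (K * t powr a) * indicator {0..c} t \<partial>lborel) =
      (\<integral>\<^sup>+t. ennreal (indicator {0..c} t * (K * t powr a)) \<partial>lborel)"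
    by (intro nn_integral_cong) (auto split: split_indicator)
  also have "\<dots> = ennreal (K * (c powr (a + 1) / (a + 1)))"
    using assms by (intro nn_integral_has_integral_lebesgue has_integral_mult_right has_integral_powr_from_0) auto
  finally show ?thesis .
qed

text \<open>The distribution function vanishes beyond \<open>B\<close>, so only the integral of a multiple of
  \<open>t\<close> to the power \<open>a - 3\<close> over \<open>(0, B)\<close> remains; it converges at \<open>0\<close> because \<open>a > 2\<close>.\<close>

lemma nn_integral_powr_weak_L2:
  fixes h :: "_ \<Rightarrow> real"
  assumes M: "sigma_finite_measure M"
    and [measurable]: "h \<in> borel_measurable M"
    and h: "\<And>x. x \<in> space M \<Longrightarrow> 0 \<le> h x" "\<And>x. x \<in> space M \<Longrightarrow> h x \<le> B"
    and weak: "\<And>t. t > 0 \<Longrightarrow> emeasure M {x \<in> space M. t < h x} \<le> ennreal (C / t\<^sup>2)"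
    and C: "C \<ge> 0" and B: "B > 0" and a: "a > 2"
  shows "(\<integral>\<^sup>+x. ennreal (h x powr a) \<partial>M) \<le> ennreal (a * C / (a - 2) * B powr (a - 2))"
proof -
  let ?k = "\<lambda>t::real. a * t powr (a - 1)"
  have "(\<integral>\<^sup>+x. ennreal (h x powr a) \<partial>M) =
      (\<integral>\<^sup>+x. (\<integral>\<^sup>+t. ennreal (?k t) * indicator {0<..<h x} t \<partial>lborel) \<partial>M)"
  proof (intro nn_integral_cong)
    fix x assume x: "x \<in> space M"
    have "(\<integral>\<^sup>+t. ennreal (?k t) * indicator {0<..<h x} t \<partial>lborel) = (\<integral>\<^sup>+t. ennreal (?k t) * indicator {0..h x} t \<partial>lborel)"
      by (intro nn_integral_cong_AE AE_I'[where N = "{0, h x}"] finite_imp_null_set_lborel)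
        (auto split: split_indicator)
    also have "\<dots> = ennreal (h x powr a)"
      using a h x by (subst nn_integral_powr_Icc) auto
    finally show "ennreal (h x powr a) = (\<integral>\<^sup>+t. ennreal (?k t) * indicator {0<..<h x} t \<partial>lborel)" by simp
  qed
  also have "\<dots> = (\<integral>\<^sup>+t. ennreal (?k t) * indicator {0<..} t * emeasure M {x \<in> space M. t < h x} \<partial>lborel)"
    by (intro nn_integral_layer_cake M) measurable
  also have "\<dots> \<le> (\<integral>\<^sup>+t. ennreal (a * C * t powr (a - 3)) * indicator {0..B} t \<partial>lborel)"
  proof (intro nn_integral_mono)
    fix t :: real
    show "ennreal (?k t) * indicator {0<..} t * emeasure M {x \<in> space M. t < h x} \<le>
        ennreal (a * C * t powr (a - 3)) * indicator {0..B} t"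
    proof (cases "0 < t \<and> t \<le> B")
      case True
      then have "ennreal (?k t) * emeasure M {x \<in> space M. t < h x} \<le> ennreal (?k t) * ennreal (C / t\<^sup>2)"
        by (intro mult_left_mono weak) auto
      also have "\<dots> = ennreal (a * C * t powr (a - 3))"
      proof -
        have "t powr (a - 1) * (C / t\<^sup>2) = C * t powr (a - 3)"
          using True powr_add[of t "a - 3" 2] by (simp add: field_simps)
        then have "?k t * (C / t\<^sup>2) = a * C * t powr (a - 3)"
          by (simp only: mult.assoc)
        moreover have "ennreal (?k t) * ennreal (C / t\<^sup>2) = ennreal (?k t * (C / t\<^sup>2))"
          using C by (intro ennreal_mult''[symmetric]) simp
        ultimately show ?thesis by simp
      qed
      finally show ?thesis using True by simp
    next
      case False
      have "emeasure M {x \<in> space M. t < h x} = 0" if "t > B"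
      proof -
        have "{x \<in> space M. t < h x} = {}"
          using h(2) that by force
        then show ?thesis by (simp only: emeasure_empty)
      qed
      then show ?thesis using False by (cases "t > B") (auto split: split_indicator)
    qed
  qed
  also have "\<dots> \<le> ennreal (a * C / (a - 2) * B powr (a - 2))"
    using nn_integral_powr_Icc[of "a - 3" B "a * C"] a B C by simp
  finally show ?thesis .
qed

section \<open>The Poisson kernel\<close>

text \<open>Normalized so that its mean over the circle with respect to \<open>\<zeta>\<close> is \<open>1\<close>.\<close>

definition poisson :: "complex \<Rightarrow> complex \<Rightarrow> real" where
  "poisson z \<zeta> = (1 - (cmod z)\<^sup>2) / (cmod (\<zeta> - z))\<^sup>2"

lemma poisson_nonneg: "cmod z < 1 \<Longrightarrow> 0 \<le> poisson z \<zeta>"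
  by (simp add: poisson_def power_le_one)

lemma poisson_le:
  assumes z: "cmod z < 1" and \<zeta>: "cmod \<zeta> = 1"
  shows "poisson z \<zeta> \<le> 2 / (1 - cmod z)"
proof -
  have "1 - cmod z \<le> cmod (\<zeta> - z)"
    using norm_triangle_ineq2[of \<zeta> z] \<zeta> by simp
  then have "(1 - cmod z)\<^sup>2 \<le> (cmod (\<zeta> - z))\<^sup>2"
    using z by (intro power_mono) auto
  then have "poisson z \<zeta> \<le> (1 - (cmod z)\<^sup>2) / (1 - cmod z)\<^sup>2"
    unfolding poisson_def using z by (intro divide_left_mono mult_pos_pos) (auto simp: power_le_one)
  also have "\<dots> = (1 + cmod z) / (1 - cmod z)"
  proof -
    have "1 - (cmod z)\<^sup>2 = (1 - cmod z) * (1 + cmod z)"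
      by (simp add: power2_eq_square algebra_simps)
    then show ?thesis
      using z by (simp add: power2_eq_square)
  qed
  also have "\<dots> \<le> 2 / (1 - cmod z)"
    using z by (intro divide_right_mono) auto
  finally show ?thesis .
qed

lemma poisson_swap:
  assumes "cmod \<xi> = 1" "cmod \<zeta> = 1"
  shows "poisson (of_real r * \<xi>) \<zeta> = poisson (of_real r * \<zeta>) \<xi>"
proof -
  have "(cmod (\<zeta> - of_real r * \<xi>))\<^sup>2 = (cmod (\<xi> - of_real r * \<zeta>))\<^sup>2"
  proof -
    have expand: "(cmod (a - of_real r * b))\<^sup>2 = (cmod a)\<^sup>2 + r\<^sup>2 * (cmod b)\<^sup>2 - 2 * r * (Re a * Re b + Im a * Im b)"
      for a b unfolding cmod_power2 by (simp add: power2_eq_square algebra_simps)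
    show ?thesis
      unfolding expand using assms by (simp add: algebra_simps)
  qed
  then show ?thesis
    using assms by (simp add: poisson_def norm_mult)
qed

lemma continuous_on_poisson [continuous_intros]:
  assumes "continuous_on S f" "continuous_on S g" "\<And>x. x \<in> S \<Longrightarrow> cmod (f x) < 1 \<and> cmod (g x) = 1"
  shows "continuous_on S (\<lambda>x. poisson (f x) (g x))"
proof -
  have "g x - f x \<noteq> 0" if "x \<in> S" for x
    using assms(3)[OF that] by auto
  then show ?thesis
    unfolding poisson_def using assms(1,2) by (intro continuous_intros) auto
qed

lemma poisson_measurable [measurable]:
  "cmod z < 1 \<Longrightarrow> poisson z \<in> borel_measurable circle_measure"
  by (intro continuous_on_measurable_circle continuous_intros) auto

text \<open>Cauchy's formula at \<open>z\<close> for \<open>G(w) = F(w) (1 - |z|\<^sup>2) / (1 - z\<^sup>* w)\<close>, where \<open>z\<^sup>*\<close> is the conjugate of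
  \<open>z\<close>: the additional factor is \<open>1\<close> at \<open>w = z\<close> and turns the Cauchy kernel into the Poisson kernel
  on the circle.\<close>

lemma poisson_integral_holomorphic:
  assumes cont: "continuous_on (cball 0 1) F" and hol: "F holomorphic_on ball 0 1" and z: "cmod z < 1"
  shows "(\<integral>\<zeta>. of_real (poisson z \<zeta>) * F \<zeta> \<partial>circle_measure) = F z"
proof -
  define G where "G = (\<lambda>w. F w * (1 - of_real ((cmod z)\<^sup>2)) / (1 - cnj z * w))"
  have nz: "1 - cnj z * w \<noteq> 0" if "cmod w \<le> 1" for w
  proof
    assume "1 - cnj z * w = 0"
    then have "cmod (cnj z * w) = 1" by (metis eq_iff_diff_eq_0 norm_one)
    moreover have "cmod (cnj z * w) \<le> cmod z * 1"
      unfolding norm_mult using that by (intro mult_mono) auto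
    ultimately show False using z by simp
  qed
  have contF: "continuous_on (sphere 0 1) F"
    using cont by (rule continuous_on_subset) auto
  have contG: "continuous_on (cball 0 1) G"
    unfolding G_def using cont nz by (intro continuous_intros) auto
  have holG: "G holomorphic_on ball 0 1"
    unfolding G_def using hol nz by (intro holomorphic_intros) auto
  have kernel: "G \<zeta> / (\<zeta> - z) = of_real (poisson z \<zeta>) * F \<zeta> / \<zeta>" if \<zeta>: "cmod \<zeta> = 1" for \<zeta>
  proof -
    have 1: "\<zeta> * cnj \<zeta> = 1"
      using \<zeta> by (simp add: complex_norm_square[symmetric])
    have "complex_of_real ((cmod (\<zeta> - z))\<^sup>2) = (\<zeta> - z) * (cnj \<zeta> - cnj z)"
      using complex_norm_square[of "\<zeta> - z"] by simp
    then have "\<zeta> * complex_of_real ((cmod (\<zeta> - z))\<^sup>2) = \<zeta> * ((\<zeta> - z) * (cnj \<zeta> - cnj z))"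
      by (rule arg_cong)
    also have "\<dots> = (\<zeta> - z) * (\<zeta> * cnj \<zeta> - cnj z * \<zeta>)"
      by (simp add: algebra_simps)
    finally have 2: "\<zeta> * complex_of_real ((cmod (\<zeta> - z))\<^sup>2) = (\<zeta> - z) * (1 - cnj z * \<zeta>)"
      by (simp only: 1)
    have "of_real (poisson z \<zeta>) * F \<zeta> / \<zeta> =
        (1 - of_real ((cmod z)\<^sup>2)) * F \<zeta> / (\<zeta> * complex_of_real ((cmod (\<zeta> - z))\<^sup>2))"
      by (simp add: poisson_def)
    also have "\<dots> = G \<zeta> / (\<zeta> - z)"
      unfolding 2 by (simp add: G_def mult_ac)
    finally show ?thesis ..
  qed
  have contk: "continuous_on (sphere 0 1) (\<lambda>\<zeta>. of_real (poisson z \<zeta>) * F \<zeta> :: complex)"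
    using z contF by (intro continuous_intros) auto
  have "((\<lambda>u. G u / (u - z)) has_contour_integral (2 * of_real pi * \<i> * G z)) (circlepath 0 1)"
    using contG holG z by (intro Cauchy_integral_circlepath) auto
  then have "contour_integral (circlepath 0 1) (\<lambda>u. G u / (u - z)) = 2 * of_real pi * \<i> * G z"
    by (rule contour_integral_unique)
  moreover have "contour_integral (circlepath 0 1) (\<lambda>u. G u / (u - z)) =
      contour_integral (circlepath 0 1) (\<lambda>\<zeta>. of_real (poisson z \<zeta>) * F \<zeta> / \<zeta>)"
    by (rule contour_integral_eq) (auto simp: kernel)
  moreover have "\<dots> = 2 * pi * \<i> * (\<integral>\<zeta>. of_real (poisson z \<zeta>) * F \<zeta> \<partial>circle_measure)"
    by (rule contour_integral_circle_eq[OF contk])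
  moreover have "G z = F z"
  proof -
    have "1 - cnj z * z = 1 - of_real ((cmod z)\<^sup>2)"
      using complex_norm_square[of z] by (simp add: mult.commute)
    then show ?thesis
      using nz[of z] z by (simp add: G_def)
  qed
  ultimately show ?thesis by simp
qed

lemma integrable_poisson_mult:
  assumes z: "cmod z < 1" and u: "integrable circle_measure u"
  shows "integrable circle_measure (\<lambda>\<zeta>. poisson z \<zeta> * u \<zeta> :: real)"
proof (rule Bochner_Integration.integrable_bound)
  show "integrable circle_measure (\<lambda>\<zeta>. 2 / (1 - cmod z) * u \<zeta>)"
    using u by simp
  show "(\<lambda>\<zeta>. poisson z \<zeta> * u \<zeta>) \<in> borel_measurable circle_measure"
    using u z by measurable
  have "\<bar>poisson z \<zeta>\<bar> \<le> \<bar>2 / (1 - cmod z)\<bar>" if "cmod \<zeta> = 1" for \<zeta>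
    using poisson_le[OF z that] poisson_nonneg[OF z, of \<zeta>] by linarith
  then show "AE \<zeta> in circle_measure. norm (poisson z \<zeta> * u \<zeta>) \<le> norm (2 / (1 - cmod z) * u \<zeta>)"
    unfolding real_norm_def abs_mult by (intro AE_I2 mult_right_mono) auto
qed

lemma poisson_integral_one:
  assumes z: "cmod z < 1"
  shows "(\<integral>\<zeta>. poisson z \<zeta> \<partial>circle_measure) = 1"
proof -
  have "complex_of_real (\<integral>\<zeta>. poisson z \<zeta> \<partial>circle_measure) = (\<integral>\<zeta>. of_real (poisson z \<zeta>) * 1 \<partial>circle_measure)"
    by simp
  also have "\<dots> = 1"
    by (rule poisson_integral_holomorphic) (use z in auto)
  finally show ?thesis by simp
qed

lemma poisson_integral_Re:
  assumes "continuous_on (cball 0 1) F" "F holomorphic_on ball 0 1" "cmod z < 1"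
  shows "(\<integral>\<zeta>. poisson z \<zeta> * Re (F \<zeta>) \<partial>circle_measure) = Re (F z)"
proof -
  have "continuous_on (sphere 0 1) F"
    using assms(1) by (rule continuous_on_subset) auto
  then have int: "integrable circle_measure (\<lambda>\<zeta>. of_real (poisson z \<zeta>) * F \<zeta>)"
    using assms(3) by (intro continuous_on_integrable_circle continuous_intros) auto
  have "Re (F z) = Re (\<integral>\<zeta>. of_real (poisson z \<zeta>) * F \<zeta> \<partial>circle_measure)"
    by (simp add: poisson_integral_holomorphic[OF assms])
  also have "\<dots> = (\<integral>\<zeta>. Re (of_real (poisson z \<zeta>) * F \<zeta>) \<partial>circle_measure)"
    by (rule integral_Re[symmetric, OF int])
  finally show ?thesis by simp
qed

section \<open>Real trigonometric polynomials\<close>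

text \<open>Real functions that are Laurent polynomials on the circle. A common negative power in the
  denominator makes closure under products immediate.\<close>

definition trig_poly :: "(complex \<Rightarrow> real) set" where
  "trig_poly = {u. \<exists>P N. \<forall>\<zeta>\<in>sphere 0 1. of_real (u \<zeta>) = poly P \<zeta> / \<zeta> ^ N}"

lemma trig_polyI: "(\<And>\<zeta>. cmod \<zeta> = 1 \<Longrightarrow> of_real (u \<zeta>) = poly P \<zeta> / \<zeta> ^ N) \<Longrightarrow> u \<in> trig_poly"
  unfolding trig_poly_def by auto

text \<open>On the circle the negative power \<open>\<zeta>\<^sup>-\<^sup>m\<close> is the conjugate of \<open>\<zeta>\<^sup>m\<close>, so under the real part it can be
  replaced by \<open>\<zeta>\<^sup>m\<close> with the conjugate coefficient.\<close>

lemma trig_poly_Re_poly: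
  assumes "u \<in> trig_poly"
  obtains Q where "\<And>\<zeta>. cmod \<zeta> = 1 \<Longrightarrow> u \<zeta> = Re (poly Q \<zeta>)"
proof -
  obtain P N where u: "\<And>\<zeta>. cmod \<zeta> = 1 \<Longrightarrow> of_real (u \<zeta>) = poly P \<zeta> / \<zeta> ^ N"
    using assms unfolding trig_poly_def by auto
  define q where "q k = (if N \<le> k then monom (coeff P k) (k - N) else monom (cnj (coeff P k)) (N - k))" for k
  have "u \<zeta> = Re (poly (\<Sum>k\<le>degree P. q k) \<zeta>)" if \<zeta>: "cmod \<zeta> = 1" for \<zeta>
  proof -
    have 1: "\<zeta> * cnj \<zeta> = 1"
      using \<zeta> by (simp add: complex_norm_square[symmetric])
    have nz: "\<zeta> \<noteq> 0" using \<zeta> by auto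
    have term_eq: "Re (coeff P k * \<zeta> ^ k / \<zeta> ^ N) = Re (poly (q k) \<zeta>)" for k
    proof (cases "N \<le> k")
      case True
      then show ?thesis using nz by (simp add: q_def poly_monom power_diff)
    next
      case False
      have "cnj \<zeta> ^ (N - k) * \<zeta> ^ (N - k) = 1"
        by (simp add: power_mult_distrib[symmetric] 1 mult.commute[of "cnj \<zeta>"])
      moreover have "\<zeta> ^ N = \<zeta> ^ (N - k) * \<zeta> ^ k"
        using False by (simp add: power_add[symmetric])
      ultimately have "\<zeta> ^ k / \<zeta> ^ N = cnj \<zeta> ^ (N - k)"
        using nz by (simp add: field_simps)
      then have "coeff P k * \<zeta> ^ k / \<zeta> ^ N = coeff P k * cnj \<zeta> ^ (N - k)"
        by (metis times_divide_eq_right)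
      then have "coeff P k * \<zeta> ^ k / \<zeta> ^ N = cnj (poly (q k) \<zeta>)"
        using False by (simp add: q_def poly_monom)
      then show ?thesis by simp
    qed
    have "u \<zeta> = Re (poly P \<zeta> / \<zeta> ^ N)"
      using u[OF \<zeta>] by (metis Re_complex_of_real)
    also have "\<dots> = (\<Sum>k\<le>degree P. Re (coeff P k * \<zeta> ^ k / \<zeta> ^ N))"
      by (simp add: poly_altdef sum_divide_distrib)
    also have "\<dots> = Re (poly (\<Sum>k\<le>degree P. q k) \<zeta>)"
      by (simp add: term_eq poly_sum)
    finally show ?thesis .
  qed
  then show ?thesis by (rule that)
qed

lemma trig_poly_function_ring: "function_ring_on trig_poly (sphere 0 1)"
proof
  show "compact (sphere (0::complex) 1)" by simp
next
  fix f assume f: "f \<in> trig_poly"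
  obtain Q where Q: "\<And>\<zeta>. cmod \<zeta> = 1 \<Longrightarrow> f \<zeta> = Re (poly Q \<zeta>)"
    using trig_poly_Re_poly[OF f] by blast
  have "continuous_on (sphere 0 1) (\<lambda>\<zeta>. Re (poly Q \<zeta>))"
    by (intro continuous_intros)
  then show "continuous_on (sphere 0 1) f"
    by (rule continuous_on_eq) (auto simp: Q)
next
  fix f g assume "f \<in> trig_poly" "g \<in> trig_poly"
  then obtain P M Q N where
    f: "\<And>\<zeta>. cmod \<zeta> = 1 \<Longrightarrow> of_real (f \<zeta>) = poly P \<zeta> / \<zeta> ^ M" and
    g: "\<And>\<zeta>. cmod \<zeta> = 1 \<Longrightarrow> of_real (g \<zeta>) = poly Q \<zeta> / \<zeta> ^ N"
    unfolding trig_poly_def by auto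
  show "(\<lambda>x. f x + g x) \<in> trig_poly"
  proof (rule trig_polyI)
    fix \<zeta> :: complex assume \<zeta>: "cmod \<zeta> = 1"
    then have "\<zeta> \<noteq> 0" by auto
    with \<zeta> show "of_real (f \<zeta> + g \<zeta>) = poly (P * monom 1 N + Q * monom 1 M) \<zeta> / \<zeta> ^ (M + N)"
      by (simp add: f g poly_monom field_simps power_add)
  qed
  show "(\<lambda>x. f x * g x) \<in> trig_poly"
    by (rule trig_polyI[where P = "P * Q" and N = "M + N"]) (simp add: f g power_add)
next
  show "(\<lambda>_. c) \<in> trig_poly" for c
    by (rule trig_polyI[where P = "[:of_real c:]" and N = 0]) simp
next
  fix x y :: complex assume xy: "x \<in> sphere 0 1" "y \<in> sphere 0 1" "x \<noteq> y"
  have inv: "1 / \<zeta> = cnj \<zeta>" if "cmod \<zeta> = 1" for \<zeta>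
  proof -
    have "\<zeta> * cnj \<zeta> = 1"
      using that by (simp add: complex_norm_square[symmetric])
    moreover have "\<zeta> \<noteq> 0" using that by auto
    ultimately show ?thesis
      by (simp add: nonzero_divide_eq_eq mult.commute)
  qed
  have "Re \<in> trig_poly"
  proof (rule trig_polyI)
    fix \<zeta> :: complex assume \<zeta>: "cmod \<zeta> = 1"
    then have "\<zeta> \<noteq> 0" by auto
    have "poly [:1/2, 0, 1/2:] \<zeta> / \<zeta> ^ 1 = (\<zeta> + 1 / \<zeta>) / 2"
      using \<open>\<zeta> \<noteq> 0\<close> by (simp add: field_simps)
    also have "\<dots> = of_real (Re \<zeta>)"
      by (simp add: inv[OF \<zeta>] complex_add_cnj)
    finally show "of_real (Re \<zeta>) = poly [:1/2, 0, 1/2:] \<zeta> / \<zeta> ^ 1" ..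
  qed
  moreover have "Im \<in> trig_poly"
  proof (rule trig_polyI)
    fix \<zeta> :: complex assume \<zeta>: "cmod \<zeta> = 1"
    then have "\<zeta> \<noteq> 0" by auto
    have "poly [:-1/(2*\<i>), 0, 1/(2*\<i>):] \<zeta> / \<zeta> ^ 1 = (\<zeta> - 1 / \<zeta>) / (2 * \<i>)"
      using \<open>\<zeta> \<noteq> 0\<close> by (simp add: field_simps)
    also have "\<dots> = of_real (Im \<zeta>)"
      by (simp add: inv[OF \<zeta>] complex_diff_cnj mult_ac)
    finally show "of_real (Im \<zeta>) = poly [:-1/(2*\<i>), 0, 1/(2*\<i>):] \<zeta> / \<zeta> ^ 1" ..
  qed
  moreover have "Re x \<noteq> Re y \<or> Im x \<noteq> Im y"
    using xy complex_eq_iff by blast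
  ultimately show "\<exists>f\<in>trig_poly. f x \<noteq> f y" by blast
qed

text \<open>The Stone-Weierstrass theorem for trigonometric polynomials. The form with a polynomial in
  \<open>\<zeta>\<close> alone provides a holomorphic function on the disk whose real part is close to \<open>u\<close>.\<close>

lemma Re_poly_dense_on_circle:
  assumes "continuous_on (sphere 0 1) u" "e > 0"
  obtains Q where "\<And>\<zeta>. cmod \<zeta> = 1 \<Longrightarrow> \<bar>u \<zeta> - Re (poly Q \<zeta>)\<bar> < e"
proof -
  interpret function_ring_on trig_poly "sphere 0 1" by (rule trig_poly_function_ring)
  obtain g where g: "g \<in> trig_poly" "\<forall>x\<in>sphere 0 1. \<bar>u x - g x\<bar> < e"
    using Stone_Weierstrass_basic[OF assms] by blast
  obtain Q where "\<And>\<zeta>. cmod \<zeta> = 1 \<Longrightarrow> g \<zeta> = Re (poly Q \<zeta>)"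
    using trig_poly_Re_poly[OF g(1)] by blast
  then show ?thesis using g(2) by (intro that[of Q]) auto
qed

section \<open>Subharmonicity of the positive logarithm\<close>

lemma log_plus_eq: "0 \<le> x \<Longrightarrow> log_plus x = ln (max 1 x)"
  by (cases "x \<le> 0") (auto simp: log_plus_def max_def)

lemma log_plus_nonneg: "0 \<le> log_plus x"
  by (simp add: log_plus_def)

lemma continuous_on_log_plus [continuous_intros]:
  assumes "continuous_on S f" 
  shows "continuous_on S (\<lambda>x. log_plus (cmod (f x)))"
proof -
  have "continuous_on S (\<lambda>x. ln (max 1 (cmod (f x))))"
    using assms by (intro continuous_intros) (auto simp: max_def)
  then show ?thesis by (simp add: log_plus_eq)
qed

lemma exp_log_plus: "0 \<le> x \<Longrightarrow> exp (log_plus x) = max 1 x"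
  by (simp add: log_plus_eq)

text \<open>Approximate \<open>log\<^sup>+ |F|\<close> on the circle by the real part of a polynomial \<open>Q\<close>. Then
  \<open>|F exp (-Q)|\<close> is at most slightly more than \<open>1\<close> on the circle, hence on the disk by the maximum
  principle, and \<open>Re Q\<close> is its own Poisson integral. Zeros of \<open>F\<close> do no harm because \<open>log\<^sup>+\<close> is
  continuous at them.\<close>

lemma log_plus_le_poisson:
  assumes cont: "continuous_on (cball 0 1) F" and hol: "F holomorphic_on ball 0 1" and z: "cmod z < 1"
  shows "log_plus (cmod (F z)) \<le> (\<integral>\<zeta>. poisson z \<zeta> * log_plus (cmod (F \<zeta>)) \<partial>circle_measure)"
    (is "_ \<le> ?I")
proof (rule field_le_epsilon)
  fix e :: real assume "e > 0"
  define d where "d = e / 2"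
  have d: "d > 0" using \<open>e > 0\<close> by (simp add: d_def)
  let ?u = "\<lambda>\<zeta>. log_plus (cmod (F \<zeta>))"
  have contF: "continuous_on (sphere 0 1) F"
    using cont by (rule continuous_on_subset) auto
  have contu: "continuous_on (sphere 0 1) ?u"
    using contF by (intro continuous_intros)
  obtain Q where Q: "\<And>\<zeta>. cmod \<zeta> = 1 \<Longrightarrow> \<bar>?u \<zeta> - Re (poly Q \<zeta>)\<bar> < d"
    using Re_poly_dense_on_circle[OF contu d] by blast
  let ?G = "\<lambda>w. F w * exp (- poly Q w)"
  have "norm (?G z) \<le> exp d"
  proof (rule maximum_modulus_frontier[where S = "cball 0 1" and f = ?G])
    show "?G holomorphic_on interior (cball 0 1)"
      using hol by (auto intro!: holomorphic_intros)
    show "continuous_on (closure (cball 0 1)) ?G"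
      using cont by (auto intro!: continuous_intros)
    show "norm (?G \<zeta>) \<le> exp d" if "\<zeta> \<in> frontier (cball 0 1)" for \<zeta>
    proof -
      have \<zeta>: "cmod \<zeta> = 1" using that by (simp add: frontier_cball)
      have "cmod (F \<zeta>) \<le> exp (?u \<zeta>)"
        by (simp add: exp_log_plus)
      then have "norm (?G \<zeta>) \<le> exp (?u \<zeta>) * exp (- Re (poly Q \<zeta>))"
        by (simp add: norm_mult norm_exp_eq_Re)
      also have "\<dots> = exp (?u \<zeta> - Re (poly Q \<zeta>))"
        by (simp add: exp_diff exp_minus field_simps)
      also have "\<dots> \<le> exp d"
        using Q[OF \<zeta>] by auto
      finally show ?thesis .
    qed
  qed (use z in auto)
  then have "cmod (F z) * exp (- Re (poly Q z)) \<le> exp d"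
    by (simp add: norm_mult norm_exp_eq_Re)
  then have Fz: "cmod (F z) \<le> exp (d + Re (poly Q z))"
    by (simp add: exp_add exp_minus field_simps)
  have "Re (poly Q z) = (\<integral>\<zeta>. poisson z \<zeta> * Re (poly Q \<zeta>) \<partial>circle_measure)"
    using z by (intro poisson_integral_Re[symmetric]) (auto intro!: continuous_intros holomorphic_intros)
  also have "\<dots> \<le> (\<integral>\<zeta>. poisson z \<zeta> * (?u \<zeta> + d) \<partial>circle_measure)"
  proof (rule integral_mono)
    show "integrable circle_measure (\<lambda>\<zeta>. poisson z \<zeta> * Re (poly Q \<zeta>))"
      using z by (intro continuous_on_integrable_circle continuous_intros) auto
    show "integrable circle_measure (\<lambda>\<zeta>. poisson z \<zeta> * (?u \<zeta> + d))"
      using z contu by (intro continuous_on_integrable_circle continuous_intros contu) auto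
    show "poisson z \<zeta> * Re (poly Q \<zeta>) \<le> poisson z \<zeta> * (?u \<zeta> + d)" if "\<zeta> \<in> space circle_measure" for \<zeta>
      using Q[of \<zeta>] that poisson_nonneg[OF z] by (intro mult_left_mono) auto
  qed
  also have "\<dots> = ?I + d"
  proof -
    have "integrable circle_measure (\<lambda>\<zeta>. poisson z \<zeta> * ?u \<zeta>)"
      using z contu by (intro continuous_on_integrable_circle continuous_intros contu) auto
    moreover have "integrable circle_measure (poisson z)"
      using z by (intro continuous_on_integrable_circle continuous_intros) auto
    ultimately show ?thesis
      using poisson_integral_one[OF z] by (simp add: distrib_left)
  qed
  finally have bound: "d + Re (poly Q z) \<le> ?I + e"
    by (simp add: d_def)
  have I: "0 \<le> ?I"
    using poisson_nonneg[OF z] by (intro integral_nonneg_AE) (simp add: log_plus_nonneg)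
  have "cmod (F z) \<le> exp (?I + e)"
    using Fz bound by (meson exp_le_cancel_iff order_trans)
  moreover have "1 \<le> exp (?I + e)"
    using I \<open>e > 0\<close> by simp
  ultimately have "ln (max 1 (cmod (F z))) \<le> ln (exp (?I + e))"
    by (intro ln_mono) auto
  then show "log_plus (cmod (F z)) \<le> ?I + e"
    by (simp add: log_plus_eq)
qed

section \<open>Nontangential boundary values\<close>

lemma stolz_region_mono: "c \<le> d \<Longrightarrow> stolz_region c \<zeta> \<subseteq> stolz_region d \<zeta>"
  unfolding stolz_region_def
  by (auto intro: less_le_trans mult_right_mono)

lemma radius_in_stolz_region:
  assumes "cmod \<zeta> = 1" "0 < r" "r < 1" "c > 1"
  shows "of_real r * \<zeta> \<in> stolz_region c \<zeta>"
proof -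
  have "cmod (of_real r * \<zeta> - \<zeta>) = cmod (of_real (r - 1) * \<zeta>)"
    by (simp add: algebra_simps)
  also have "\<dots> = 1 - r"
    using assms unfolding norm_mult norm_of_real by simp
  finally show ?thesis
    using assms by (simp add: stolz_region_def norm_mult)
qed

lemma has_nt_limit_radial:
  assumes lim: "has_nt_limit f \<zeta> L" and \<zeta>: "cmod \<zeta> = 1"
    and r: "r \<longlonglongrightarrow> 1" "\<And>n. 0 < r n" "\<And>n. r n < 1"
  shows "(\<lambda>n. f (of_real (r n) * \<zeta>)) \<longlonglongrightarrow> L"
proof -
  have "((\<lambda>n. of_real (r n) * \<zeta>) \<longlongrightarrow> of_real 1 * \<zeta>) sequentially"
    by (intro tendsto_intros r)
  moreover have "of_real (r n) * \<zeta> \<in> stolz_region 2 \<zeta> \<and> of_real (r n) * \<zeta> \<noteq> \<zeta>" for n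
    using radius_in_stolz_region[OF \<zeta> r(2,3)] r(3)[of n] \<zeta> by auto
  ultimately have "filterlim (\<lambda>n. of_real (r n) * \<zeta>) (at \<zeta> within stolz_region 2 \<zeta>) sequentially"
    by (simp add: filterlim_at)
  moreover have "(f \<longlongrightarrow> L) (at \<zeta> within stolz_region 2 \<zeta>)"
    using lim by (simp add: has_nt_limit_def)
  ultimately show ?thesis
    by (rule filterlim_compose[rotated])
qed

text \<open>One fixed sequence of radii suffices for measurability and for Fatou's lemma.\<close>

definition radii :: "nat \<Rightarrow> real" where
  "radii n = 1 - 1 / real (n + 2)"

lemma radii: "radii \<longlonglongrightarrow> 1" "0 < radii n" "radii n < 1"
proof -
  show "radii \<longlonglongrightarrow> 1" unfolding radii_def by real_asymp
qed (auto simp: radii_def)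

lemma nt_boundary_eq:
  assumes "has_nt_limit f \<zeta> L" "cmod \<zeta> = 1"
  shows "nt_boundary f \<zeta> = L"
proof -
  have "L' = L''" if "has_nt_limit f \<zeta> L'" "has_nt_limit f \<zeta> L''" for L' L''
    using that[THEN has_nt_limit_radial, OF assms(2) radii(1-3)] LIMSEQ_unique by blast
  then have "(THE L. has_nt_limit f \<zeta> L) = L"
    using assms(1) by (intro the_equality) auto
  then show ?thesis
    using assms by (auto simp: nt_boundary_def)
qed

text \<open>By completeness a limit exists precisely under the Cauchy condition, and by monotonicity
  in the aperture it suffices to consider countably many Stolz regions. In this form only countable
  quantifiers remain outside a closed condition on \<open>\<zeta>\<close>.\<close>

lemma nt_limit_Cauchy_iff:
  assumes \<zeta>: "cmod \<zeta> = 1"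
  shows "(\<exists>L. has_nt_limit f \<zeta> L) \<longleftrightarrow>
    (\<forall>c k :: nat. \<exists>m :: nat. \<forall>z w. z \<in> stolz_region (real c + 2) \<zeta> \<and> dist z \<zeta> < 1 / (real m + 1) \<and>
       w \<in> stolz_region (real c + 2) \<zeta> \<and> dist w \<zeta> < 1 / (real m + 1) \<longrightarrow> dist (f z) (f w) \<le> 1 / (real k + 1))"
    (is "?L \<longleftrightarrow> ?R")
proof
  assume ?L
  then obtain L where L: "has_nt_limit f \<zeta> L" by blast
  show ?R
  proof (intro allI)
    fix c k :: nat
    have "(f \<longlongrightarrow> L) (at \<zeta> within stolz_region (real c + 2) \<zeta>)"
      using L by (auto simp: has_nt_limit_def)
    moreover have "1 / (2 * (real k + 1)) > 0" by simp
    ultimately have "\<forall>\<^sub>F z in at \<zeta> within stolz_region (real c + 2) \<zeta>. dist (f z) L < 1 / (2 * (real k + 1))"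
      by (rule tendstoD)
    then obtain d where d: "d > 0"
      "\<And>z. z \<in> stolz_region (real c + 2) \<zeta> \<Longrightarrow> z \<noteq> \<zeta> \<Longrightarrow> dist z \<zeta> < d \<Longrightarrow> dist (f z) L < 1 / (2 * (real k + 1))"
      unfolding eventually_at by blast
    obtain m :: nat where m: "1 / (real m + 1) < d"
      using reals_Archimedean[OF \<open>d > 0\<close>] by (auto simp: inverse_eq_divide add.commute)
    have "dist (f z) (f w) \<le> 1 / (real k + 1)"
      if z: "z \<in> stolz_region (real c + 2) \<zeta>" "dist z \<zeta> < 1 / (real m + 1)"
        and w: "w \<in> stolz_region (real c + 2) \<zeta>" "dist w \<zeta> < 1 / (real m + 1)" for z w
    proof -
      have "z \<noteq> \<zeta>" "w \<noteq> \<zeta>"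
        using z w \<zeta> by (auto simp: stolz_region_def)
      then have "dist (f z) L < 1 / (2 * (real k + 1))" "dist (f w) L < 1 / (2 * (real k + 1))"
        using d(2)[of z] d(2)[of w] z w m by (meson order.strict_trans)+
      then have "dist (f z) (f w) < 1 / (2 * (real k + 1)) + 1 / (2 * (real k + 1))"
        by (rule dist_triangle_less_add)
      also have "\<dots> = 1 / (real k + 1)"
        by (simp add: field_simps)
      finally show ?thesis by simp
    qed
    then show "\<exists>m :: nat. \<forall>z w. z \<in> stolz_region (real c + 2) \<zeta> \<and> dist z \<zeta> < 1 / (real m + 1) \<and>
       w \<in> stolz_region (real c + 2) \<zeta> \<and> dist w \<zeta> < 1 / (real m + 1) \<longrightarrow> dist (f z) (f w) \<le> 1 / (real k + 1)"
      by blast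
  qed
next
  assume R: ?R
  define z where "z n = of_real (radii n) * \<zeta>" for n
  have zS: "z n \<in> stolz_region (real c + 2) \<zeta>" for n c
    unfolding z_def by (intro radius_in_stolz_region \<zeta> radii) auto
  have "z \<longlonglongrightarrow> of_real 1 * \<zeta>"
    unfolding z_def by (intro tendsto_intros radii)
  then have zlim: "\<forall>\<^sub>F n in sequentially. dist (z n) \<zeta> < 1 / (real m + 1)" for m :: nat
    by (intro tendstoD) auto
  have Cauchy: "\<exists>m :: nat. \<forall>z w. z \<in> stolz_region (real c + 2) \<zeta> \<and> dist z \<zeta> < 1 / (real m + 1) \<and>
       w \<in> stolz_region (real c + 2) \<zeta> \<and> dist w \<zeta> < 1 / (real m + 1) \<longrightarrow> dist (f z) (f w) < e"
    if "e > 0" for c and e :: real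
  proof -
    obtain k :: nat where "1 / (real k + 1) < e"
      using reals_Archimedean[OF \<open>e > 0\<close>] by (auto simp: inverse_eq_divide add.commute)
    then show ?thesis
      using R[rule_format, of c k] by (meson le_less_trans)
  qed
  have "Cauchy (\<lambda>n. f (z n))"
  proof (rule metric_CauchyI)
    fix e :: real assume "e > 0"
    then obtain m :: nat where m: "\<And>x w. x \<in> stolz_region (real 0 + 2) \<zeta> \<Longrightarrow> dist x \<zeta> < 1 / (real m + 1) \<Longrightarrow>
       w \<in> stolz_region (real 0 + 2) \<zeta> \<Longrightarrow> dist w \<zeta> < 1 / (real m + 1) \<Longrightarrow> dist (f x) (f w) < e"
      using Cauchy by metis
    obtain M where "\<And>n. n \<ge> M \<Longrightarrow> dist (z n) \<zeta> < 1 / (real m + 1)"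
      using zlim[of m] by (auto simp: eventually_sequentially)
    then show "\<exists>M. \<forall>i\<ge>M. \<forall>j\<ge>M. dist (f (z i)) (f (z j)) < e"
      using m zS by blast
  qed
  then obtain L where L: "(\<lambda>n. f (z n)) \<longlonglongrightarrow> L"
    using Cauchy_convergent convergent_def by blast
  have "has_nt_limit f \<zeta> L"
    unfolding has_nt_limit_def
  proof (intro allI impI tendstoI)
    fix c e :: real assume "c > 1" "e > 0"
    obtain c' :: nat where c': "c \<le> real c' + 2"
      using real_arch_simple[of c] by (meson add_increasing2 zero_le_numeral)
    obtain m :: nat where m: "\<And>x w. x \<in> stolz_region (real c' + 2) \<zeta> \<Longrightarrow> dist x \<zeta> < 1 / (real m + 1) \<Longrightarrow>
       w \<in> stolz_region (real c' + 2) \<zeta> \<Longrightarrow> dist w \<zeta> < 1 / (real m + 1) \<Longrightarrow> dist (f x) (f w) < e / 2"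
      using Cauchy[of "e / 2" c'] \<open>e > 0\<close> by (metis half_gt_zero)
    have "dist (f x) L < e" if x: "x \<in> stolz_region c \<zeta>" "dist x \<zeta> < 1 / (real m + 1)" for x
    proof -
      have xS: "x \<in> stolz_region (real c' + 2) \<zeta>"
        using stolz_region_mono[OF c'] x by blast
      have "\<forall>\<^sub>F n in sequentially. dist (f x) (f (z n)) \<le> e / 2"
        using zlim[of m]
      proof eventually_elim
        case (elim n)
        show ?case
          using m[OF xS x(2) zS elim] by simp
      qed
      moreover have "(\<lambda>n. dist (f x) (f (z n))) \<longlonglongrightarrow> dist (f x) L"
        by (intro tendsto_intros L)
      ultimately have "dist (f x) L \<le> e / 2"
        by (intro tendsto_upperbound) auto
      then show ?thesis using \<open>e > 0\<close> by linarith
    qed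
    then show "\<forall>\<^sub>F x in at \<zeta> within stolz_region c \<zeta>. dist (f x) L < e"
      unfolding eventually_at by (intro exI[of _ "1 / (real m + 1)"]) auto
  qed
  then show ?L ..
qed

text \<open>For fixed aperture, tolerance and radius the Cauchy condition is closed in \<open>\<zeta>\<close>: each pair of
  points violating it lies in the truncated Stolz regions of an open set of \<open>\<zeta>\<close>.\<close>

lemma borel_nt_limit_set: "{\<zeta> \<in> sphere 0 1. \<exists>L. has_nt_limit f \<zeta> L} \<in> sets borel"
proof -
  define T where "T c k m = {\<zeta>. \<forall>z w. z \<in> stolz_region (real c + 2) \<zeta> \<and> dist z \<zeta> < 1 / (real m + 1) \<and>
       w \<in> stolz_region (real c + 2) \<zeta> \<and> dist w \<zeta> < 1 / (real m + 1) \<longrightarrow> dist (f z) (f w) \<le> 1 / (real k + 1)}"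
    for c k m :: nat
  have op: "open {\<zeta>. z \<in> stolz_region (real c + 2) \<zeta> \<and> dist z \<zeta> < 1 / (real m + 1)}" for z and c m :: nat
  proof -
    have "open ({\<zeta>. cmod (z - \<zeta>) < (real c + 2) * (1 - cmod z)} \<inter> {\<zeta>. dist z \<zeta> < 1 / (real m + 1)})"
      by (intro open_Int open_Collect_less continuous_intros)
    moreover have "{\<zeta>. z \<in> stolz_region (real c + 2) \<zeta> \<and> dist z \<zeta> < 1 / (real m + 1)} =
      (if z \<in> ball 0 1 then {\<zeta>. cmod (z - \<zeta>) < (real c + 2) * (1 - cmod z)} \<inter> {\<zeta>. dist z \<zeta> < 1 / (real m + 1)} else {})"
      by (auto simp: stolz_region_def)
    ultimately show ?thesis by simp
  qed
  have "closed (T c k m)" for c k m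
  proof -
    have "T c k m = (\<Inter>(z, w) \<in> {(z, w). \<not> dist (f z) (f w) \<le> 1 / (real k + 1)}.
      - ({\<zeta>. z \<in> stolz_region (real c + 2) \<zeta> \<and> dist z \<zeta> < 1 / (real m + 1)} \<inter>
         {\<zeta>. w \<in> stolz_region (real c + 2) \<zeta> \<and> dist w \<zeta> < 1 / (real m + 1)}))"
      unfolding T_def by blast
    also have "closed \<dots>"
      by (intro closed_INT ballI) (auto intro!: closed_Compl open_Int op)
    finally show ?thesis .
  qed
  then have [measurable]: "T c k m \<in> sets borel" for c k m by simp
  have "{\<zeta> \<in> sphere 0 1. \<exists>L. has_nt_limit f \<zeta> L} = sphere 0 1 \<inter> (\<Inter>c. \<Inter>k. \<Union>m. T c k m)"
  proof (rule set_eqI)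
    fix \<zeta>
    show "\<zeta> \<in> {\<zeta> \<in> sphere 0 1. \<exists>L. has_nt_limit f \<zeta> L} \<longleftrightarrow> \<zeta> \<in> sphere 0 1 \<inter> (\<Inter>c. \<Inter>k. \<Union>m. T c k m)"
      by (cases "cmod \<zeta> = 1") (simp_all add: nt_limit_Cauchy_iff T_def)
  qed
  also have "\<dots> \<in> sets borel"
    by measurable
  finally show ?thesis .
qed

lemma continuous_on_radial:
  fixes f :: "complex \<Rightarrow> complex"
  assumes "continuous_on (ball 0 1) f" "0 \<le> r" "r < 1"
  shows "continuous_on (cball 0 1) (\<lambda>\<zeta>. f (of_real r * \<zeta>))"
proof (rule continuous_on_compose2[OF assms(1)])
  show "(\<lambda>\<zeta>::complex. of_real r * \<zeta>) ` cball 0 1 \<subseteq> ball 0 1"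
  proof (rule image_subsetI)
    fix x :: complex assume "x \<in> cball 0 1"
    then have "r * cmod x \<le> r * 1"
      using assms by (intro mult_left_mono) auto
    then show "of_real r * x \<in> ball 0 1"
      using assms by (simp add: norm_mult)
  qed
qed (intro continuous_intros)

text \<open>The boundary function is a radial limit on the Borel set where nontangential limits exist,
  and \<open>0\<close> elsewhere.\<close>

lemma nt_boundary_measurable:
  assumes "continuous_on (ball 0 1) f"
  shows "nt_boundary f \<in> borel_measurable circle_measure"
proof -
  let ?E = "{\<zeta> \<in> sphere 0 1. \<exists>L. has_nt_limit f \<zeta> L}"
  have E: "?E \<in> sets circle_measure"
    by (rule borel_sets_circle[OF borel_nt_limit_set]) auto
  show ?thesis
  proof (rule borel_measurable_LIMSEQ_metric)
    fix n
    have "continuous_on (sphere 0 1) (\<lambda>\<zeta>. f (of_real (radii n) * \<zeta>))"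
      by (rule continuous_on_subset[OF continuous_on_radial[OF assms]]) (auto simp: radii less_imp_le)
    then have "(\<lambda>\<zeta>. f (of_real (radii n) * \<zeta>)) \<in> borel_measurable circle_measure"
      by (rule continuous_on_measurable_circle)
    then show "(\<lambda>\<zeta>. indicator ?E \<zeta> *\<^sub>R f (of_real (radii n) * \<zeta>)) \<in> borel_measurable circle_measure"
      using E by measurable
  next
    fix \<zeta> assume "\<zeta> \<in> space circle_measure"
    then have \<zeta>: "cmod \<zeta> = 1" by simp
    show "(\<lambda>n. indicator ?E \<zeta> *\<^sub>R f (of_real (radii n) * \<zeta>)) \<longlonglongrightarrow> nt_boundary f \<zeta>"
    proof (cases "\<exists>L. has_nt_limit f \<zeta> L")
      case True
      then obtain L where L: "has_nt_limit f \<zeta> L" by blast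
      have "(\<lambda>n. f (of_real (radii n) * \<zeta>)) \<longlonglongrightarrow> L"
        by (rule has_nt_limit_radial[OF L \<zeta> radii(1-3)])
      then show ?thesis
        using True \<zeta> nt_boundary_eq[OF L \<zeta>] by simp
    next
      case False
      then show ?thesis by (simp add: nt_boundary_def)
    qed
  qed
qed

section \<open>The Poisson majorant of a Smirnov function\<close>

lemma tendsto_log_plus:
  assumes "(f \<longlongrightarrow> L) F"
  shows "((\<lambda>x. log_plus (cmod (f x))) \<longlongrightarrow> log_plus (cmod L)) F"
proof -
  have "continuous_on UNIV (\<lambda>z::complex. log_plus (cmod z))"
    by (intro continuous_intros)
  then have "isCont (\<lambda>z::complex. log_plus (cmod z)) L"
    by (simp add: continuous_on_eq_continuous_at)
  then show ?thesis
    using assms by (rule isCont_tendsto_compose)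
qed

text \<open>Let \<open>u\<^sub>n\<close> be \<open>log\<^sup>+ |f|\<close> on the circle of radius \<open>r\<^sub>n\<close> and \<open>u\<close> the same for the boundary
  function. Then \<open>u\<close> is at most the lower limit of the \<open>u\<^sub>n\<close> everywhere, since \<open>u\<close> is \<open>0\<close> where
  no nontangential limit exists. With \<open>K\<close> an upper bound of the Poisson kernel \<open>P\<close>, Fatou's lemma for
  \<open>(K - P) u\<^sub>n\<close> together with convergence of the means of \<open>u\<^sub>n\<close> bounds the upper limit of the Poisson
  integrals of \<open>u\<^sub>n\<close> by the Poisson integral of \<open>u\<close>.\<close>

lemma smirnov_log_plus_le_poisson:
  assumes f: "f \<in> smirnov_class" and z: "cmod z < 1"
  shows "integrable circle_measure (\<lambda>\<zeta>. log_plus (cmod (nt_boundary f \<zeta>)))"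
    and "log_plus (cmod (f z)) \<le> (\<integral>\<zeta>. poisson z \<zeta> * log_plus (cmod (nt_boundary f \<zeta>)) \<partial>circle_measure)"
proof -
  have hol: "f holomorphic_on ball 0 1"
    and bdd: "(SUP r\<in>{0<..<1}. log_mean (\<lambda>\<zeta>. f (of_real r * \<zeta>))) < \<infinity>"
    and lim: "((\<lambda>r. log_mean (\<lambda>\<zeta>. f (of_real r * \<zeta>))) \<longlongrightarrow> log_mean (nt_boundary f)) (at_left 1)"
    using f by (auto simp: smirnov_class_def nevanlinna_class_def)
  let ?u = "\<lambda>\<zeta>. log_plus (cmod (nt_boundary f \<zeta>))"
  let ?un = "\<lambda>n \<zeta>. log_plus (cmod (f (of_real (radii n) * \<zeta>)))"
  define K where "K = 2 / (1 - cmod z)"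
  have contf: "continuous_on (ball 0 1) f"
    using hol by (rule holomorphic_on_imp_continuous_on)
  have cball: "continuous_on (cball 0 1) (\<lambda>\<zeta>. f (of_real (radii n) * \<zeta>))" for n
    by (rule continuous_on_radial[OF contf]) (auto simp: radii less_imp_le)
  have cont: "continuous_on (sphere 0 1) (\<lambda>\<zeta>. f (of_real (radii n) * \<zeta>))" for n
    by (rule continuous_on_subset[OF cball]) auto
  have int_un: "integrable circle_measure (?un n)" for n
    by (intro continuous_on_integrable_circle continuous_intros cont)
  have "filterlim radii (at_left 1) sequentially"
    using radii unfolding filterlim_at by (auto simp: less_imp_neq)
  then have limn: "(\<lambda>n. log_mean (\<lambda>\<zeta>. f (of_real (radii n) * \<zeta>))) \<longlonglongrightarrow> log_mean (nt_boundary f)"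
    by (rule filterlim_compose[OF lim])
  have "log_mean (nt_boundary f) \<le> (SUP r\<in>{0<..<1}. log_mean (\<lambda>\<zeta>. f (of_real r * \<zeta>)))"
    by (rule LIMSEQ_le_const2[OF limn]) (auto intro!: SUP_upper simp: radii)
  with bdd have fin: "log_mean (nt_boundary f) < \<infinity>" by order
  have meas: "nt_boundary f \<in> borel_measurable circle_measure"
    by (rule nt_boundary_measurable[OF contf])
  have "(\<lambda>z::complex. log_plus (cmod z)) \<in> borel_measurable borel"
    by (intro borel_measurable_continuous_onI continuous_intros)
  from measurable_compose[OF meas this] have u_meas: "?u \<in> borel_measurable circle_measure" .
  show int_u: "integrable circle_measure ?u"
    using fin u_meas by (intro integrableI_nonneg) (auto simp: log_mean_def log_plus_nonneg)
  define A where "A = (\<integral>\<zeta>. ?u \<zeta> \<partial>circle_measure)"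
  define An where "An n = (\<integral>\<zeta>. ?un n \<zeta> \<partial>circle_measure)" for n
  have "log_mean (nt_boundary f) = ennreal A"
    unfolding log_mean_def A_def by (intro nn_integral_eq_integral int_u) (simp add: log_plus_nonneg)
  moreover have "log_mean (\<lambda>\<zeta>. f (of_real (radii n) * \<zeta>)) = ennreal (An n)" for n
    unfolding log_mean_def An_def by (intro nn_integral_eq_integral int_un) (simp add: log_plus_nonneg)
  moreover have A0: "A \<ge> 0" "An n \<ge> 0" for n
    unfolding A_def An_def by (auto intro!: integral_nonneg_AE simp: log_plus_nonneg)
  ultimately have "(\<lambda>n. ennreal (An n)) \<longlonglongrightarrow> ennreal A"
    using limn by simp
  then have An: "An \<longlonglongrightarrow> A"
    using A0 by (simp add: tendsto_ennreal_iff)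
  have PK: "0 \<le> K - poisson z \<zeta>" if "cmod \<zeta> = 1" for \<zeta>
    using poisson_le[OF z that] by (simp add: K_def)
  let ?v = "\<lambda>n \<zeta>. (K - poisson z \<zeta>) * ?un n \<zeta>"
  let ?vl = "\<lambda>\<zeta>. (K - poisson z \<zeta>) * ?u \<zeta>"
  have int_v: "integrable circle_measure (?v n)" for n
    using integrable_poisson_mult[OF z int_un] int_un by (simp add: left_diff_distrib)
  have int_vl: "integrable circle_measure ?vl"
    using integrable_poisson_mult[OF z int_u] int_u by (simp add: left_diff_distrib)
  have v_le: "(\<integral>\<zeta>. ?v n \<zeta> \<partial>circle_measure) \<le> K * An n - log_plus (cmod (f (of_real (radii n) * z)))" for n
  proof -
    have "(\<integral>\<zeta>. ?v n \<zeta> \<partial>circle_measure) = K * An n - (\<integral>\<zeta>. poisson z \<zeta> * ?un n \<zeta> \<partial>circle_measure)"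
      using integrable_poisson_mult[OF z int_un] int_un by (simp add: left_diff_distrib An_def)
    moreover have "(\<lambda>\<zeta>. f (of_real (radii n) * \<zeta>)) holomorphic_on ball 0 1"
    proof (rule holomorphic_on_compose_gen[OF _ hol, unfolded o_def])
      show "(\<lambda>\<zeta>::complex. of_real (radii n) * \<zeta>) ` ball 0 1 \<subseteq> ball 0 1"
      proof (rule image_subsetI)
        fix x :: complex assume "x \<in> ball 0 1"
        then have "radii n * cmod x \<le> 1 * cmod x"
          using radii(2,3)[of n] by (intro mult_right_mono) auto
        then show "of_real (radii n) * x \<in> ball 0 1"
          using \<open>x \<in> ball 0 1\<close> radii(2,3)[of n] by (simp add: norm_mult)
      qed
    qed (intro holomorphic_intros)
    ultimately show ?thesis
      using log_plus_le_poisson[OF cball _ z] by fastforce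
  qed
  define y where "y = K * A - log_plus (cmod (f z))"
  have ylim: "(\<lambda>n. K * An n - log_plus (cmod (f (of_real (radii n) * z)))) \<longlonglongrightarrow> y"
  proof -
    have "isCont f z"
      using contf z by (simp add: continuous_on_eq_continuous_at)
    moreover have "(\<lambda>n. of_real (radii n) * z) \<longlonglongrightarrow> of_real 1 * z"
      by (intro tendsto_intros radii)
    ultimately have "(\<lambda>n. f (of_real (radii n) * z)) \<longlonglongrightarrow> f z"
      by (intro isCont_tendsto_compose[where g = f]) simp_all
    then show ?thesis
      unfolding y_def by (intro tendsto_intros An tendsto_log_plus)
  qed
  have y0: "0 \<le> y"
  proof (rule LIMSEQ_le_const[OF ylim], intro exI allI impI)
    fix n :: nat
    have "0 \<le> (\<integral>\<zeta>. ?v n \<zeta> \<partial>circle_measure)"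
      using PK by (intro integral_nonneg_AE AE_I2) (auto simp: log_plus_nonneg)
    then show "0 \<le> K * An n - log_plus (cmod (f (of_real (radii n) * z)))"
      using v_le[of n] by linarith
  qed
  have "ennreal (\<integral>\<zeta>. ?vl \<zeta> \<partial>circle_measure) = (\<integral>\<^sup>+\<zeta>. ennreal (?vl \<zeta>) \<partial>circle_measure)"
    using PK by (intro nn_integral_eq_integral[symmetric] int_vl AE_I2) (auto simp: log_plus_nonneg)
  also have "\<dots> \<le> (\<integral>\<^sup>+\<zeta>. liminf (\<lambda>n. ennreal (?v n \<zeta>)) \<partial>circle_measure)"
  proof (rule nn_integral_mono)
    fix \<zeta> assume "\<zeta> \<in> space circle_measure"
    then have \<zeta>: "cmod \<zeta> = 1" by simp
    show "ennreal (?vl \<zeta>) \<le> liminf (\<lambda>n. ennreal (?v n \<zeta>))"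
    proof (cases "\<exists>L. has_nt_limit f \<zeta> L")
      case True
      then obtain L where L: "has_nt_limit f \<zeta> L" by blast
      have "(\<lambda>n. f (of_real (radii n) * \<zeta>)) \<longlonglongrightarrow> nt_boundary f \<zeta>"
        unfolding nt_boundary_eq[OF L \<zeta>] by (rule has_nt_limit_radial[OF L \<zeta> radii(1-3)])
      then have "(\<lambda>n. ennreal (?v n \<zeta>)) \<longlonglongrightarrow> ennreal (?vl \<zeta>)"
        by (intro tendsto_intros tendsto_log_plus)
      then show ?thesis
        by (simp add: lim_imp_Liminf)
    next
      case False
      \<comment> \<open>Here the boundary function is \<open>0\<close> by convention, so the left-hand side vanishes.\<close>
      then show ?thesis by (simp add: nt_boundary_def log_plus_def)
    qed
  qed
  also have "\<dots> \<le> liminf (\<lambda>n. \<integral>\<^sup>+\<zeta>. ennreal (?v n \<zeta>) \<partial>circle_measure)"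
    using int_v by (intro nn_integral_liminf) auto
  also have "\<dots> \<le> liminf (\<lambda>n. ennreal (K * An n - log_plus (cmod (f (of_real (radii n) * z)))))"
  proof (intro Liminf_mono always_eventually allI)
    fix n
    have "(\<integral>\<^sup>+\<zeta>. ennreal (?v n \<zeta>) \<partial>circle_measure) = ennreal (\<integral>\<zeta>. ?v n \<zeta> \<partial>circle_measure)"
      using PK by (intro nn_integral_eq_integral int_v AE_I2) (auto simp: log_plus_nonneg)
    then show "(\<integral>\<^sup>+\<zeta>. ennreal (?v n \<zeta>) \<partial>circle_measure) \<le>
      ennreal (K * An n - log_plus (cmod (f (of_real (radii n) * z))))"
      using v_le[of n] by (simp add: ennreal_leI)
  qed
  also have "\<dots> = ennreal y"
    by (intro lim_imp_Liminf tendsto_ennrealI ylim) simp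
  finally have "(\<integral>\<zeta>. ?vl \<zeta> \<partial>circle_measure) \<le> y"
    using y0 by simp
  moreover have "(\<integral>\<zeta>. ?vl \<zeta> \<partial>circle_measure) = K * A - (\<integral>\<zeta>. poisson z \<zeta> * ?u \<zeta> \<partial>circle_measure)"
    using integrable_poisson_mult[OF z int_u] int_u by (simp add: left_diff_distrib A_def)
  ultimately show "log_plus (cmod (f z)) \<le> (\<integral>\<zeta>. poisson z \<zeta> * ?u \<zeta> \<partial>circle_measure)"
    by (simp add: y_def)
qed

section \<open>Growth of the integral means\<close>

lemma circle_id_measurable: "(\<lambda>\<zeta>. \<zeta>) \<in> borel_measurable circle_measure"
  by (intro continuous_on_measurable_circle continuous_intros)

lemma poisson_pair_measurable:
  "(\<lambda>(\<zeta>, \<xi>). poisson (of_real r * \<zeta>) \<xi>) \<in> borel_measurable (circle_measure \<Otimes>\<^sub>M circle_measure)"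
proof -
  note [measurable] = measurable_compose[OF measurable_fst circle_id_measurable]
    measurable_compose[OF measurable_snd circle_id_measurable]
  show ?thesis
    unfolding poisson_def split_beta by measurable
qed

text \<open>Write \<open>g \<le> t + max 0 (g - t)\<close>; the excess has integral at most \<open>C / t\<close>. The pointwise bound
  follows from \<open>P \<le> 2 / (1 - r)\<close> with the balancing choice \<open>t\<^sup>2 = 1 / (1 - r)\<close>. For the distribution
  of \<open>h\<close>, cut at \<open>t / 2\<close>: the Poisson integral of the excess has the same mean on the circle of radius
  \<open>r\<close> as the excess itself, by the symmetry \<open>poisson_swap\<close>, and Markov's inequality applies.\<close>

lemma weak_L2_poisson_majorant_bounds:
  assumes gm [measurable]: "g \<in> borel_measurable circle_measure"
    and g0: "\<And>\<zeta>. 0 \<le> g \<zeta>"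
    and weak: "\<And>t. t > 0 \<Longrightarrow> emeasure circle_measure {\<zeta> \<in> sphere 0 1. t < g \<zeta>} \<le> ennreal (C / t\<^sup>2)"
    and C: "C \<ge> 0"
    and r: "0 \<le> r" "r < 1"
    and hm [measurable]: "h \<in> borel_measurable circle_measure"
    and h: "\<And>\<zeta>. cmod \<zeta> = 1 \<Longrightarrow> h \<zeta> \<le> (\<integral>\<xi>. poisson (of_real r * \<zeta>) \<xi> * g \<xi> \<partial>circle_measure)"
  shows "cmod \<zeta> = 1 \<Longrightarrow> h \<zeta> \<le> (1 + 2 * C) * (1 - r) powr (- 1 / 2)"
    and "t > 0 \<Longrightarrow> emeasure circle_measure {\<zeta> \<in> sphere 0 1. t < h \<zeta>} \<le> ennreal (4 * C / t\<^sup>2)"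
    and "integrable circle_measure g"
proof -
  let ?ex = "\<lambda>t \<xi>. max 0 (g \<xi> - t)"
  have excess: "(\<integral>\<^sup>+\<xi>. ennreal (?ex t \<xi>) \<partial>circle_measure) \<le> ennreal (C / t)" if "t > 0" for t
    using that weak C by (intro nn_integral_excess_weak_L2 circle.sigma_finite_measure_axioms gm) auto
  have int_ex: "integrable circle_measure (?ex t)" if "t > 0" for t
    using excess[OF that] by (intro integrableI_nonneg) (auto simp: top_unique less_top[symmetric])
  have ex_le: "(\<integral>\<xi>. ?ex t \<xi> \<partial>circle_measure) \<le> C / t" if "t > 0" for t
  proof -
    have "ennreal (\<integral>\<xi>. ?ex t \<xi> \<partial>circle_measure) = (\<integral>\<^sup>+\<xi>. ennreal (?ex t \<xi>) \<partial>circle_measure)"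
      by (intro nn_integral_eq_integral[symmetric] int_ex that) auto
    also have "\<dots> \<le> ennreal (C / t)"
      by (rule excess[OF that])
    finally show ?thesis
      using C that by (subst (asm) ennreal_le_iff) auto
  qed
  show g_int: "integrable circle_measure g"
  proof (rule Bochner_Integration.integrable_bound)
    show "integrable circle_measure (\<lambda>\<xi>. 1 + ?ex 1 \<xi>)"
      using int_ex[of 1] by simp
  qed (use g0 in auto)
  have zr: "cmod (of_real r * \<zeta>) < 1" if "cmod \<zeta> = 1" for \<zeta>
    using that r by (simp add: norm_mult)
  have split: "h \<zeta> \<le> t + (\<integral>\<xi>. poisson (of_real r * \<zeta>) \<xi> * ?ex t \<xi> \<partial>circle_measure)"
    if t: "t > 0" and \<zeta>: "cmod \<zeta> = 1" for t \<zeta>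
  proof -
    let ?P = "poisson (of_real r * \<zeta>)"
    have "h \<zeta> \<le> (\<integral>\<xi>. ?P \<xi> * g \<xi> \<partial>circle_measure)"
      by (rule h[OF \<zeta>])
    also have "\<dots> \<le> (\<integral>\<xi>. ?P \<xi> * (t + ?ex t \<xi>) \<partial>circle_measure)"
      using int_ex[OF t] g_int zr[OF \<zeta>] poisson_nonneg[OF zr[OF \<zeta>]]
      by (intro integral_mono integrable_poisson_mult mult_left_mono) auto
    also have "\<dots> = (\<integral>\<xi>. ?P \<xi> * t \<partial>circle_measure) + (\<integral>\<xi>. ?P \<xi> * ?ex t \<xi> \<partial>circle_measure)"
      unfolding distrib_left
      using int_ex[OF t] zr[OF \<zeta>] by (intro Bochner_Integration.integral_add integrable_poisson_mult) auto
    also have "(\<integral>\<xi>. ?P \<xi> * t \<partial>circle_measure) = t"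
      using poisson_integral_one[OF zr[OF \<zeta>]] by simp
    finally show ?thesis .
  qed
  show "h \<zeta> \<le> (1 + 2 * C) * (1 - r) powr (- 1 / 2)" if \<zeta>: "cmod \<zeta> = 1"
  proof -
    \<comment> \<open>The two terms \<open>t\<close> and \<open>2 / (1 - r) * (C / t)\<close> balance at this height.\<close>
    define t where "t = (1 - r) powr (- 1 / 2)"
    have t: "t > 0" using r by (simp add: t_def)
    have tt: "1 / (1 - r) = t * t"
      using r by (simp add: t_def powr_add[symmetric] powr_minus_divide)
    let ?P = "poisson (of_real r * \<zeta>)"
    have Ple: "?P \<xi> \<le> 2 / (1 - r)" if "cmod \<xi> = 1" for \<xi>
      using poisson_le[OF zr[OF \<zeta>] that] r \<zeta> by (simp add: norm_mult)
    have "(\<integral>\<xi>. ?P \<xi> * ?ex t \<xi> \<partial>circle_measure) \<le> (\<integral>\<xi>. 2 / (1 - r) * ?ex t \<xi> \<partial>circle_measure)"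
      using int_ex[OF t] zr[OF \<zeta>] Ple
      by (intro integral_mono integrable_poisson_mult mult_right_mono) auto
    also have "\<dots> = 2 * (t * t) * (\<integral>\<xi>. ?ex t \<xi> \<partial>circle_measure)"
      by (simp add: tt[symmetric])
    also have "\<dots> \<le> 2 * (t * t) * (C / t)"
      using ex_le[OF t] t by (intro mult_left_mono) auto
    also have "\<dots> = 2 * C * t"
      using t by simp
    finally have "h \<zeta> \<le> t + 2 * C * t"
      using split[OF t \<zeta>] by linarith
    then show ?thesis by (simp add: t_def algebra_simps)
  qed
  show "emeasure circle_measure {\<zeta> \<in> sphere 0 1. t < h \<zeta>} \<le> ennreal (4 * C / t\<^sup>2)" if "t > 0"
  proof -
    define s where "s = t / 2"
    have s: "s > 0" using that by (simp add: s_def)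
    define H where "H \<zeta> = (\<integral>\<^sup>+\<xi>. ennreal (poisson (of_real r * \<zeta>) \<xi>) * ennreal (?ex s \<xi>) \<partial>circle_measure)" for \<zeta>
    have Pm [measurable]: "(\<lambda>(\<zeta>, \<xi>). ennreal (poisson (of_real r * \<zeta>) \<xi>) * ennreal (?ex s \<xi>))
        \<in> borel_measurable (circle_measure \<Otimes>\<^sub>M circle_measure)"
      using poisson_pair_measurable[of r] unfolding split_beta by measurable
    have Hm: "H \<in> borel_measurable circle_measure"
      unfolding H_def using circle.borel_measurable_nn_integral[OF Pm] by simp
    have sub: "{\<zeta> \<in> sphere 0 1. t < h \<zeta>} \<subseteq> {\<zeta> \<in> space circle_measure. 1 \<le> ennreal (1 / s) * H \<zeta>}"
    proof safe
      fix \<zeta> assume "\<zeta> \<in> sphere (0::complex) 1" and th: "t < h \<zeta>"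
      then have \<zeta>: "cmod \<zeta> = 1" by simp
      have "H \<zeta> = (\<integral>\<^sup>+\<xi>. ennreal (poisson (of_real r * \<zeta>) \<xi> * ?ex s \<xi>) \<partial>circle_measure)"
        unfolding H_def by (intro nn_integral_cong) (simp add: ennreal_mult'')
      also have "\<dots> = ennreal (\<integral>\<xi>. poisson (of_real r * \<zeta>) \<xi> * ?ex s \<xi> \<partial>circle_measure)"
        using int_ex[OF s] zr[OF \<zeta>] poisson_nonneg[OF zr[OF \<zeta>]]
        by (intro nn_integral_eq_integral integrable_poisson_mult) auto
      also have "\<dots> \<ge> ennreal s"
        using split[OF s \<zeta>] th by (intro ennreal_leI) (simp add: s_def)
      finally have "ennreal (1 / s) * ennreal s \<le> ennreal (1 / s) * H \<zeta>"
        by (intro mult_left_mono) auto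
      moreover have "ennreal (1 / s) * ennreal s = 1"
        using s by (simp add: ennreal_mult''[symmetric])
      ultimately show "1 \<le> ennreal (1 / s) * H \<zeta>" by simp
    qed (simp add: space_circle_measure)
    have "emeasure circle_measure {\<zeta> \<in> sphere 0 1. t < h \<zeta>} \<le>
        emeasure circle_measure {\<zeta> \<in> space circle_measure. 1 \<le> ennreal (1 / s) * H \<zeta>}"
      using Hm by (intro emeasure_mono sub) measurable
    also have "\<dots> \<le> ennreal (1 / s) * (\<integral>\<^sup>+\<zeta>. H \<zeta> * indicator (space circle_measure) \<zeta> \<partial>circle_measure)"
      by (intro nn_integral_Markov_inequality borel_measurable_times_ennreal Hm
          borel_measurable_indicator sets.top)
    also have "(\<integral>\<^sup>+\<zeta>. H \<zeta> * indicator (space circle_measure) \<zeta> \<partial>circle_measure) = (\<integral>\<^sup>+\<zeta>. H \<zeta> \<partial>circle_measure)"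
      by (intro nn_integral_cong) simp
    also have "\<dots> = (\<integral>\<^sup>+\<xi>. (\<integral>\<^sup>+\<zeta>. ennreal (poisson (of_real r * \<zeta>) \<xi>) * ennreal (?ex s \<xi>) \<partial>circle_measure) \<partial>circle_measure)"
    proof -
      interpret pair_sigma_finite circle_measure circle_measure
        by (simp add: pair_sigma_finite_def circle.sigma_finite_measure_axioms)
      show ?thesis
        unfolding H_def by (rule Fubini'[symmetric]) (rule Pm)
    qed
    also have "\<dots> = (\<integral>\<^sup>+\<xi>. ennreal (?ex s \<xi>) \<partial>circle_measure)"
    proof (rule nn_integral_cong)
      fix \<xi> assume "\<xi> \<in> space circle_measure"
      then have \<xi>: "cmod \<xi> = 1" by simp
      have "(\<integral>\<^sup>+\<zeta>. ennreal (poisson (of_real r * \<zeta>) \<xi>) * ennreal (?ex s \<xi>) \<partial>circle_measure) =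
          (\<integral>\<^sup>+\<zeta>. ennreal (?ex s \<xi>) * ennreal (poisson (of_real r * \<xi>) \<zeta>) \<partial>circle_measure)"
      proof (rule nn_integral_cong)
        fix \<zeta> assume "\<zeta> \<in> space circle_measure"
        then have "poisson (of_real r * \<zeta>) \<xi> = poisson (of_real r * \<xi>) \<zeta>"
          by (intro poisson_swap \<xi>) simp
        then show "ennreal (poisson (of_real r * \<zeta>) \<xi>) * ennreal (?ex s \<xi>) =
            ennreal (?ex s \<xi>) * ennreal (poisson (of_real r * \<xi>) \<zeta>)"
          by (simp only: mult.commute)
      qed
      also have "\<dots> = ennreal (?ex s \<xi>) * (\<integral>\<^sup>+\<zeta>. ennreal (poisson (of_real r * \<xi>) \<zeta>) \<partial>circle_measure)"
        using poisson_measurable[OF zr[OF \<xi>]] by (intro nn_integral_cmult) simp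
      also have "(\<integral>\<^sup>+\<zeta>. ennreal (poisson (of_real r * \<xi>) \<zeta>) \<partial>circle_measure) =
          ennreal (\<integral>\<zeta>. poisson (of_real r * \<xi>) \<zeta> \<partial>circle_measure)"
        using poisson_nonneg[OF zr[OF \<xi>]] integrable_poisson_mult[OF zr[OF \<xi>], of "\<lambda>_. 1"]
        by (intro nn_integral_eq_integral) auto
      also have "\<dots> = 1"
        by (simp add: poisson_integral_one[OF zr[OF \<xi>]])
      finally show "(\<integral>\<^sup>+\<zeta>. ennreal (poisson (of_real r * \<zeta>) \<xi>) * ennreal (?ex s \<xi>) \<partial>circle_measure) = ennreal (?ex s \<xi>)"
        by simp
    qed
    also have "ennreal (1 / s) * \<dots> \<le> ennreal (1 / s) * ennreal (C / s)"
      by (intro mult_left_mono excess s) simp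
    also have "\<dots> = ennreal (4 * C / t\<^sup>2)"
      using s C that by (simp add: ennreal_mult[symmetric] s_def power2_eq_square)
    finally show ?thesis .
  qed
qed

text \<open>Integrate the tangent line inequality for the exponential at the Poisson integral of \<open>v\<close>.\<close>

lemma jensen_exp_poisson:
  assumes z: "cmod z < 1" and v: "integrable circle_measure v"
    and ev: "integrable circle_measure (\<lambda>\<zeta>. exp (v \<zeta>))"
  shows "exp (\<integral>\<zeta>. poisson z \<zeta> * v \<zeta> \<partial>circle_measure) \<le> (\<integral>\<zeta>. poisson z \<zeta> * exp (v \<zeta>) \<partial>circle_measure)"
proof -
  define b where "b = (\<integral>\<zeta>. poisson z \<zeta> * v \<zeta> \<partial>circle_measure)"
  have int: "integrable circle_measure (\<lambda>\<zeta>. poisson z \<zeta> * v \<zeta>)" "integrable circle_measure (poisson z)"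
    using integrable_poisson_mult[OF z v] integrable_poisson_mult[OF z, of "\<lambda>_. 1"] by auto
  have "exp b = exp b * (1 - b) * (\<integral>\<zeta>. poisson z \<zeta> \<partial>circle_measure) + exp b * b"
    by (simp add: poisson_integral_one[OF z] algebra_simps)
  also have "\<dots> = (\<integral>\<zeta>. exp b * (1 - b) * poisson z \<zeta> + exp b * (poisson z \<zeta> * v \<zeta>) \<partial>circle_measure)"
    using int by (simp add: b_def)
  also have "\<dots> \<le> (\<integral>\<zeta>. poisson z \<zeta> * exp (v \<zeta>) \<partial>circle_measure)"
  proof (rule integral_mono)
    show "integrable circle_measure (\<lambda>\<zeta>. exp b * (1 - b) * poisson z \<zeta> + exp b * (poisson z \<zeta> * v \<zeta>))"
      using int by simp
    show "integrable circle_measure (\<lambda>\<zeta>. poisson z \<zeta> * exp (v \<zeta>))"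
      by (rule integrable_poisson_mult[OF z ev])
    fix \<zeta>
    have "exp b * (1 + (v \<zeta> - b)) \<le> exp b * exp (v \<zeta> - b)"
      by (intro mult_left_mono exp_ge_add_one_self) auto
    then have "exp b * (1 + (v \<zeta> - b)) \<le> exp (v \<zeta>)"
      by (simp add: exp_add[symmetric])
    then have "poisson z \<zeta> * (exp b * (1 + (v \<zeta> - b))) \<le> poisson z \<zeta> * exp (v \<zeta>)"
      by (intro mult_left_mono poisson_nonneg z)
    then show "exp b * (1 - b) * poisson z \<zeta> + exp b * (poisson z \<zeta> * v \<zeta>) \<le> poisson z \<zeta> * exp (v \<zeta>)"
      by (simp add: algebra_simps)
  qed
  finally show ?thesis by (simp add: b_def)
qed

text \<open>With \<open>q = p/2\<close>, the function \<open>|f|\<^sup>q\<close> has a Poisson majorant in weak \<open>L\<^sup>2\<close>, and the mean of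
  \<open>|f|\<close> is that of the power \<open>a = 2/p\<close> of \<open>|f|\<^sup>q\<close>. The hypothesis \<open>p < 1\<close> is exactly \<open>a > 2\<close>, which
  makes the pointwise bound determine the growth.\<close>

lemma smirnov_weak_Lp_mean_growth:
  assumes f: "f \<in> smirnov_class" and p: "0 < p" "p < 1" and C: "C \<ge> 1"
    and weak: "\<And>t. t > 0 \<Longrightarrow> distribution_fn (nt_boundary f) t \<le> C * t powr (- p)"
  obtains K where "\<And>r. 0 \<le> r \<Longrightarrow> r < 1 \<Longrightarrow>
    (\<integral>\<zeta>. cmod (f (of_real r * \<zeta>)) \<partial>circle_measure) \<le> K * (1 - r) powr (1 - 1 / p)"
proof -
  define q where "q = p / 2"
  define a where "a = 2 / p"
  have q: "q > 0" and a: "a > 2" and aq: "q * a = 1"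
    using p by (auto simp: q_def a_def field_simps)
  have contf: "continuous_on (ball 0 1) f"
    using f by (auto simp: smirnov_class_def nevanlinna_class_def intro: holomorphic_on_imp_continuous_on)
  define u where "u \<zeta> = log_plus (cmod (nt_boundary f \<zeta>))" for \<zeta>
  define g where "g \<zeta> = exp (q * u \<zeta>)" for \<zeta>
  have bm [measurable]: "nt_boundary f \<in> borel_measurable circle_measure"
    by (rule nt_boundary_measurable[OF contf])
  have u_int: "integrable circle_measure u"
    using smirnov_log_plus_le_poisson(1)[OF f, of 0] by (simp add: u_def[abs_def])
  have gm [measurable]: "g \<in> borel_measurable circle_measure"
    using u_int unfolding g_def by measurable
  have g_weak: "emeasure circle_measure {\<zeta> \<in> sphere 0 1. t < g \<zeta>} \<le> ennreal (C / t\<^sup>2)" if t: "t > 0" for t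
  proof (cases "t < 1")
    case True
    then have "t * t \<le> 1 * C"
      using t C by (intro mult_mono) auto
    then have "1 \<le> C / t\<^sup>2"
      using t by (simp add: power2_eq_square field_simps)
    then have "(1::ennreal) \<le> ennreal (C / t\<^sup>2)"
      by simp
    moreover have "emeasure circle_measure {\<zeta> \<in> sphere 0 1. t < g \<zeta>} \<le> 1"
      by (rule circle.emeasure_le_1)
    ultimately show ?thesis by order
  next
    case False
    have "t powr (1 / q) < cmod (nt_boundary f \<zeta>)" if "t < g \<zeta>" for \<zeta>
    proof -
      have "t powr (1 / q) < (exp (q * u \<zeta>)) powr (1 / q)"
        using that t q by (intro powr_less_mono2) (auto simp: g_def)
      also have "\<dots> = exp (u \<zeta>)"
        using q by (simp add: powr_def)
      also have "\<dots> = max 1 (cmod (nt_boundary f \<zeta>))"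
        by (simp add: u_def exp_log_plus)
      finally have "t powr (1 / q) < max 1 (cmod (nt_boundary f \<zeta>))" .
      moreover have "1 \<le> t powr (1 / q)"
        using False q by (intro ge_one_powr_ge_zero) auto
      ultimately show ?thesis by simp
    qed
    then have "emeasure circle_measure {\<zeta> \<in> sphere 0 1. t < g \<zeta>} \<le>
        emeasure circle_measure {\<zeta> \<in> sphere 0 1. t powr (1 / q) < cmod (nt_boundary f \<zeta>)}"
      by (intro emeasure_mono) (auto simp: space_circle_measure[symmetric] simp del: space_circle_measure mem_sphere)
    also have "\<dots> = ennreal (distribution_fn (nt_boundary f) (t powr (1 / q)))"
      by (simp add: distribution_fn_def circle.emeasure_eq_measure)
    also have "\<dots> \<le> ennreal (C * (t powr (1 / q)) powr (- p))"
      using t by (intro ennreal_leI weak) simp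
    also have "C * (t powr (1 / q)) powr (- p) = C / t\<^sup>2"
      using t p by (simp add: powr_powr q_def powr_minus_divide)
    finally show ?thesis .
  qed
  define B where "B r = (1 + 2 * C) * (1 - r) powr (- 1 / 2)" for r
  show ?thesis
  proof (rule that)
    fix r :: real assume r: "0 \<le> r" "r < 1"
    define h where "h \<zeta> = cmod (f (of_real r * \<zeta>)) powr q" for \<zeta>
    have cont: "continuous_on (sphere 0 1) (\<lambda>\<zeta>. f (of_real r * \<zeta>))"
      by (rule continuous_on_subset[OF continuous_on_radial[OF contf r]]) auto
    have hm [measurable]: "h \<in> borel_measurable circle_measure"
      unfolding h_def using q by (intro continuous_on_measurable_circle continuous_on_powr' continuous_intros cont) auto
    have g_int: "integrable circle_measure g"
      by (rule weak_L2_poisson_majorant_bounds(3)[OF gm _ g_weak _ r, of "\<lambda>_. 0"])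
        (use C r in \<open>auto simp: g_def norm_mult intro!: integral_nonneg_AE AE_I2 mult_nonneg_nonneg poisson_nonneg\<close>)
    have h_le: "h \<zeta> \<le> (\<integral>\<xi>. poisson (of_real r * \<zeta>) \<xi> * g \<xi> \<partial>circle_measure)" if \<zeta>: "cmod \<zeta> = 1" for \<zeta>
    proof -
      let ?z = "of_real r * \<zeta>"
      have z: "cmod ?z < 1" using \<zeta> r by (simp add: norm_mult)
      have "h \<zeta> \<le> exp (log_plus (cmod (f ?z))) powr q"
        unfolding h_def using q by (intro powr_mono2) (auto simp: exp_log_plus)
      also have "\<dots> = exp (q * log_plus (cmod (f ?z)))"
        by (simp add: powr_def)
      also have "\<dots> \<le> exp (q * (\<integral>\<xi>. poisson ?z \<xi> * u \<xi> \<partial>circle_measure))"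
        using q smirnov_log_plus_le_poisson(2)[OF f z] by (simp add: u_def)
      also have "q * (\<integral>\<xi>. poisson ?z \<xi> * u \<xi> \<partial>circle_measure) = (\<integral>\<xi>. poisson ?z \<xi> * (q * u \<xi>) \<partial>circle_measure)"
        by (simp add: mult.left_commute)
      also have "exp \<dots> \<le> (\<integral>\<xi>. poisson ?z \<xi> * exp (q * u \<xi>) \<partial>circle_measure)"
        using u_int g_int[unfolded g_def] by (intro jensen_exp_poisson z) auto
      finally show ?thesis by (simp add: g_def)
    qed
    note bounds = weak_L2_poisson_majorant_bounds[OF gm _ g_weak _ r hm h_le]
    have h_bound: "h \<zeta> \<le> B r" if "cmod \<zeta> = 1" for \<zeta>
      unfolding B_def by (rule bounds(1)) (use that C in \<open>auto simp: g_def\<close>)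
    have h_weak: "emeasure circle_measure {\<zeta> \<in> sphere 0 1. t < h \<zeta>} \<le> ennreal (4 * C / t\<^sup>2)" if "t > 0" for t
      by (rule bounds(2)) (use that C in \<open>auto simp: g_def\<close>)
    have "ennreal (\<integral>\<zeta>. cmod (f (of_real r * \<zeta>)) \<partial>circle_measure) =
        (\<integral>\<^sup>+\<zeta>. ennreal (cmod (f (of_real r * \<zeta>))) \<partial>circle_measure)"
      by (intro nn_integral_eq_integral[symmetric] continuous_on_integrable_circle continuous_intros cont) auto
    also have "\<dots> = (\<integral>\<^sup>+\<zeta>. ennreal (h \<zeta> powr a) \<partial>circle_measure)"
      by (simp add: h_def powr_powr aq)
    also have "\<dots> \<le> ennreal (a * (4 * C) / (a - 2) * B r powr (a - 2))"
      using h_bound h_weak C a r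
      by (intro nn_integral_powr_weak_L2 circle.sigma_finite_measure_axioms hm) (auto simp: h_def B_def)
    finally have "(\<integral>\<zeta>. cmod (f (of_real r * \<zeta>)) \<partial>circle_measure) \<le> a * (4 * C) / (a - 2) * B r powr (a - 2)"
      using a C by simp
    also have "B r powr (a - 2) = (1 + 2 * C) powr (a - 2) * (1 - r) powr (1 - 1 / p)"
    proof -
      have "- 1 / 2 * (a - 2) = 1 - 1 / p"
        using p by (simp add: a_def field_simps)
      then show ?thesis
        using r C by (simp add: B_def powr_mult powr_powr)
    qed
    finally show "(\<integral>\<zeta>. cmod (f (of_real r * \<zeta>)) \<partial>circle_measure) \<le>
        (a * (4 * C) / (a - 2) * (1 + 2 * C) powr (a - 2)) * (1 - r) powr (1 - 1 / p)"
      by (simp add: mult.assoc)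
  qed
qed

section \<open>Coefficients of weak Hardy functions\<close>

text \<open>Cauchy's formula for the derivatives at \<open>0\<close>.\<close>

lemma taylor_coeff_le_circle_mean:
  assumes cont: "continuous_on (cball 0 1) F"
    and sums: "\<And>w. w \<in> ball 0 1 \<Longrightarrow> (\<lambda>n. b n * w ^ n) sums F w"
  shows "cmod (b n) \<le> (\<integral>\<zeta>. cmod (F \<zeta>) \<partial>circle_measure)"
proof -
  have hol: "F holomorphic_on ball 0 1"
    by (rule power_series_holomorphic[where a = b]) (use sums in auto)
  have contF: "continuous_on (sphere 0 1) F"
    using cont by (rule continuous_on_subset) auto
  have "F has_fps_expansion Abs_fps b"
    unfolding has_fps_expansion_def
  proof
    have "summable (\<lambda>n. b n * (1 / 2) ^ n)"
      using sums[of "1 / 2"] by (auto intro: sums_summable)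
    then have "conv_radius b \<ge> norm (1 / 2 :: complex)"
      by (rule conv_radius_geI)
    then show "fps_conv_radius (Abs_fps b) > 0"
      unfolding fps_conv_radius_def by (auto intro: less_le_trans[of _ "ereal (1 / 2)"])
    have "\<forall>\<^sub>F z in nhds 0. z \<in> ball 0 (1::real)"
      by (intro eventually_nhds_in_open) auto
    then show "\<forall>\<^sub>F z in nhds 0. eval_fps (Abs_fps b) z = F z"
      by eventually_elim (use sums in \<open>auto simp: eval_fps_def sums_iff\<close>)
  qed
  then have b: "b n = (deriv ^^ n) F 0 / fact n"
    using fps_nth_fps_expansion by fastforce
  have contq: "continuous_on (sphere 0 1) (\<lambda>\<zeta>. F \<zeta> / \<zeta> ^ n)"
    by (intro continuous_intros contF) auto
  have "2 * pi * \<i> * b n = contour_integral (circlepath 0 1) (\<lambda>\<zeta>. F \<zeta> / (\<zeta> - 0) ^ Suc n)"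
    unfolding b using Cauchy_contour_integral_circlepath[OF cont hol, of 0 n] by simp
  also have "\<dots> = contour_integral (circlepath 0 1) (\<lambda>\<zeta>. F \<zeta> / \<zeta> ^ n / \<zeta>)"
    by (intro contour_integral_eq) (auto simp: mult.commute)
  also have "\<dots> = 2 * pi * \<i> * (\<integral>\<zeta>. F \<zeta> / \<zeta> ^ n \<partial>circle_measure)"
    by (rule contour_integral_circle_eq[OF contq])
  finally have "b n = (\<integral>\<zeta>. F \<zeta> / \<zeta> ^ n \<partial>circle_measure)"
    by simp
  then have "cmod (b n) \<le> (\<integral>\<zeta>. cmod (F \<zeta> / \<zeta> ^ n) \<partial>circle_measure)"
    by (simp only: integral_norm_bound)
  also have "\<dots> = (\<integral>\<zeta>. cmod (F \<zeta>) \<partial>circle_measure)"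
    by (intro Bochner_Integration.integral_cong) (auto simp: norm_divide norm_power)
  finally show ?thesis .
qed

lemma superlevel_set_measurable:
  fixes g :: "complex \<Rightarrow> complex"
  assumes [measurable]: "g \<in> borel_measurable circle_measure"
  shows "{\<zeta> \<in> sphere 0 1. cmod (g \<zeta>) > t} \<in> sets circle_measure"
proof -
  have "{\<zeta> \<in> space circle_measure. cmod (g \<zeta>) > t} \<in> sets circle_measure"
    by measurable
  then show ?thesis by simp
qed

text \<open>The superlevel sets decrease to the empty set, so their measures tend to \<open>0\<close>. Without this
  the infimum in the rearrangement would have no meaning.\<close>

lemma rearrangement_set_nonempty:
  assumes g: "g \<in> borel_measurable circle_measure" and s: "s > 0"
  shows "{t. t \<ge> 0 \<and> distribution_fn g t \<le> s} \<noteq> {}"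
proof -
  let ?A = "\<lambda>n :: nat. {\<zeta> \<in> sphere 0 1. cmod (g \<zeta>) > real n}"
  have "(\<lambda>n. measure circle_measure (?A n)) \<longlonglongrightarrow> measure circle_measure (\<Inter>n. ?A n)"
  proof (rule circle.finite_Lim_measure_decseq)
    show "range ?A \<subseteq> sets circle_measure"
      using superlevel_set_measurable[OF g] by blast
  qed (auto simp: decseq_def)
  also have "(\<Inter>n. ?A n) = {}"
  proof (rule equals0I)
    fix \<zeta> assume "\<zeta> \<in> (\<Inter>n. ?A n)"
    then have "real n < cmod (g \<zeta>)" for n by auto
    then show False
      using reals_Archimedean2 less_asym by blast
  qed
  finally have "(\<lambda>n. distribution_fn g (real n)) \<longlonglongrightarrow> 0"
    by (simp add: distribution_fn_def)
  then have "\<forall>\<^sub>F n in sequentially. distribution_fn g (real n) < s"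
    using s by (rule order_tendstoD)
  then obtain n where "distribution_fn g (real n) < s"
    by (auto simp: eventually_sequentially)
  then show ?thesis by (auto intro!: exI[of _ "real n"])
qed

lemma rearrangement_nonneg:
  assumes g: "g \<in> borel_measurable circle_measure" and s: "s > 0"
  shows "rearrangement g s \<ge> 0"
  unfolding rearrangement_def
  by (rule cInf_greatest[OF rearrangement_set_nonempty[OF assms]]) auto

lemma rearrangement_le:
  assumes "t \<ge> 0" "distribution_fn g t \<le> s"
  shows "rearrangement g s \<le> t"
  unfolding rearrangement_def using assms by (intro cInf_lower bdd_belowI[of _ 0]) auto

lemma distribution_fn_antimono:
  assumes g: "g \<in> borel_measurable circle_measure" and "t' \<le> t"
  shows "distribution_fn g t \<le> distribution_fn g t'"
  unfolding distribution_fn_def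
  using assms by (intro circle.finite_measure_mono superlevel_set_measurable) auto

text \<open>The rearrangement is the generalized inverse of the distribution function: for every \<open>s\<close> above
  the claimed bound, the rearrangement at \<open>s\<close> is below \<open>t\<close>, so some level below \<open>t\<close> has a superlevel
  set of measure at most \<open>s\<close>.\<close>

lemma distribution_fn_le_of_rearrangement:
  assumes g: "g \<in> borel_measurable circle_measure" and p: "p > 0" and M: "M \<ge> 0"
    and R: "\<And>s. s > 0 \<Longrightarrow> rearrangement g s * s powr (1 / p) \<le> M" and t: "t > 0"
  shows "distribution_fn g t \<le> M powr p * t powr (- p)"
proof (rule dense_ge)
  fix s assume s: "M powr p * t powr (- p) < s"
  have "0 \<le> M powr p * t powr (- p)" by simp
  with s have s0: "s > 0" by linarith
  have "(M powr p * t powr (- p)) powr (1 / p) < s powr (1 / p)"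
    using s p by (intro powr_less_mono2) auto
  moreover have "(M powr p * t powr (- p)) powr (1 / p) = M / t"
    using M t p by (simp add: powr_divide powr_powr powr_minus_divide)
  ultimately have "M < t * s powr (1 / p)"
    using t by (simp add: field_simps)
  with R[OF s0] have "rearrangement g s * s powr (1 / p) < t * s powr (1 / p)"
    by linarith
  then have "Inf {t. t \<ge> 0 \<and> distribution_fn g t \<le> s} < t"
    using s0 by (simp add: rearrangement_def)
  then obtain t' where "distribution_fn g t' \<le> s" "t' < t"
    using cInf_lessD[OF rearrangement_set_nonempty[OF g s0]] by blast
  then show "distribution_fn g t \<le> s"
    using distribution_fn_antimono[OF g, of t' t] by linarith
qed

text \<open>Cauchy's estimate on the circle of radius \<open>1 - 1/(2n)\<close>, on which \<open>r\<^sup>n\<close> is at least \<open>1/2\<close> by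
  Bernoulli's inequality.\<close>

lemma weak_hardy0_coeff_bound:
  assumes f: "f \<in> weak_hardy0 p" and p: "0 < p" "p < 1"
    and sums: "\<And>z. z \<in> ball 0 1 \<Longrightarrow> (\<lambda>n. a n * z ^ n) sums f z"
  obtains K where "K \<ge> 0" "\<And>n. cmod (a n) \<le> K * weight (1 / p - 1) n"
proof -
  have smirnov: "f \<in> smirnov_class"
    and bdd: "bdd_above ((\<lambda>s. rearrangement (nt_boundary f) s * s powr (1 / p)) ` {0<..})"
    using f by (auto simp: weak_hardy0_def)
  have contf: "continuous_on (ball 0 1) f"
    using smirnov by (auto simp: smirnov_class_def nevanlinna_class_def intro: holomorphic_on_imp_continuous_on)
  note bm = nt_boundary_measurable[OF contf]
  obtain M0 where M0: "\<And>s. s > 0 \<Longrightarrow> rearrangement (nt_boundary f) s * s powr (1 / p) \<le> M0"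
    using bdd by (auto simp: bdd_above_def)
  define M where "M = max 1 M0"
  have dist: "distribution_fn (nt_boundary f) t \<le> M powr p * t powr (- p)" if "t > 0" for t
    using M0 p that by (intro distribution_fn_le_of_rearrangement bm) (auto simp: M_def intro: max.coboundedI2)
  have "1 \<le> M powr p"
    using p by (intro ge_one_powr_ge_zero) (auto simp: M_def)
  then obtain K where K: "\<And>r. 0 \<le> r \<Longrightarrow> r < 1 \<Longrightarrow>
      (\<integral>\<zeta>. cmod (f (of_real r * \<zeta>)) \<partial>circle_measure) \<le> K * (1 - r) powr (1 - 1 / p)"
    using smirnov_weak_Lp_mean_growth[OF smirnov p _ dist] by metis
  have coeff: "cmod (a n) * r ^ n \<le> K * (1 - r) powr (1 - 1 / p)" if r: "0 \<le> r" "r < 1" for n r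
  proof -
    have "cmod (a n * of_real r ^ n) \<le> (\<integral>\<zeta>. cmod (f (of_real r * \<zeta>)) \<partial>circle_measure)"
    proof (rule taylor_coeff_le_circle_mean)
      show "continuous_on (cball 0 1) (\<lambda>\<zeta>. f (of_real r * \<zeta>))"
        by (rule continuous_on_radial[OF contf r])
      fix w :: complex assume "w \<in> ball 0 1"
      then have "r * cmod w \<le> 1 * cmod w" "cmod w < 1"
        using r by (auto intro: mult_left_le_one_le)
      then have "of_real r * w \<in> ball 0 1"
        using r by (simp add: norm_mult)
      from sums[OF this] show "(\<lambda>n. a n * of_real r ^ n * w ^ n) sums f (of_real r * w)"
        by (simp add: power_mult_distrib mult.assoc)
    qed
    also have "\<dots> \<le> K * (1 - r) powr (1 - 1 / p)"
      by (rule K[OF r])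
    finally show ?thesis
      using r by (simp add: norm_mult norm_power)
  qed
  have K0: "0 \<le> K"
    using coeff[of 0 0] by (simp add: order_trans[OF norm_ge_zero])
  define K' where "K' = 2 * 2 powr (1 / p - 1) * K"
  show ?thesis
  proof (rule that)
    show "0 \<le> max (cmod (a 0)) K'"
      by (simp add: le_max_iff_disj)
    fix n
    show "cmod (a n) \<le> max (cmod (a 0)) K' * weight (1 / p - 1) n"
    proof (cases "n = 0")
      case True
      then show ?thesis by (simp add: weight_def)
    next
      case False
      define r where "r = 1 - 1 / (2 * real n)"
      have r: "0 \<le> r" "r < 1"
        using False by (auto simp: r_def field_simps)
      have "1 + real n * (- 1 / (2 * real n)) \<le> (1 + (- 1 / (2 * real n))) ^ n"
        using False by (intro Bernoulli_inequality) (auto simp: field_simps)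
      then have "1 / 2 \<le> r ^ n"
        using False by (simp add: r_def)
      then have "cmod (a n) * (1 / 2) \<le> cmod (a n) * r ^ n"
        by (intro mult_left_mono) auto
      also have "\<dots> \<le> K * (1 - r) powr (1 - 1 / p)"
        by (rule coeff[OF r])
      also have "(1 - r) powr (1 - 1 / p) = (2 * real n) powr (1 / p - 1)"
        using False powr_minus_divide[of "2 * real n" "1 - 1 / p"] by (simp add: r_def powr_divide)
      also have "\<dots> = 2 powr (1 / p - 1) * real n powr (1 / p - 1)"
        by (simp add: powr_mult)
      finally have "cmod (a n) \<le> K' * real n powr (1 / p - 1)"
        by (simp add: K'_def mult_ac)
      also have "\<dots> \<le> max (cmod (a 0)) K' * real n powr (1 / p - 1)"
        by (intro mult_right_mono) auto
      finally show ?thesis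
        using False by (simp add: weight_def)
    qed
  qed
qed

lemma ell_solid:
  assumes y: "y \<in> ell s" and K: "K \<ge> 0" and le: "\<And>n. cmod (x n) \<le> K * cmod (y n)"
  shows "x \<in> ell s"
proof (cases "s = \<infinity>")
  case True
  then obtain B where B: "\<And>n. cmod (y n) \<le> B"
    using y by (auto simp: ell_def bounded_iff)
  have "cmod (x n) \<le> K * B" for n
    using le[of n] mult_left_mono[OF B K] order_trans by blast
  then show ?thesis
    using True by (auto simp: ell_def bounded_iff)
next
  case False
  let ?s = "enn2real s"
  have "summable (\<lambda>n. K powr ?s * cmod (y n) powr ?s)"
    using y False by (auto simp: ell_def intro: summable_mult)
  moreover have "norm (cmod (x n) powr ?s) \<le> K powr ?s * cmod (y n) powr ?s" for n
    using powr_mono2[OF _ _ le, of ?s] K by (simp add: powr_mult)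
  ultimately have "summable (\<lambda>n. cmod (x n) powr ?s)"
    by (rule summable_comparison_test')
  then show ?thesis
    using False by (simp add: ell_def)
qed

lemma weight_nonneg: "0 \<le> weight \<alpha> n"
  by (simp add: weight_def)

lemma weighted_ell_subset_multipliers:
  assumes p: "0 < p" "p < 1"
  shows "weighted (ell s) (1 / p - 1) \<subseteq> multipliers (coeff_seqs (weak_hardy0 p)) (ell s)"
  unfolding multipliers_def
proof (intro subsetI CollectI ballI)
  fix l a assume l: "l \<in> weighted (ell s) (1 / p - 1)" and "a \<in> coeff_seqs (weak_hardy0 p)"
  then obtain f where f: "f \<in> weak_hardy0 p" "\<And>z. z \<in> ball 0 1 \<Longrightarrow> (\<lambda>n. a n * z ^ n) sums f z"
    by (auto simp: coeff_seqs_def)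
  obtain K where K: "K \<ge> 0" "\<And>n. cmod (a n) \<le> K * weight (1 / p - 1) n"
    using weak_hardy0_coeff_bound[OF f(1) p f(2)] by metis
  show "(\<lambda>n. l n * a n) \<in> ell s"
  proof (rule ell_solid)
    show "(\<lambda>n. of_real (weight (1 / p - 1) n) * l n) \<in> ell s"
      using l by (simp add: weighted_def)
    show "cmod (l n * a n) \<le> K * cmod (of_real (weight (1 / p - 1) n) * l n)" for n
      using mult_left_mono[OF K(2)[of n], of "cmod (l n)"]
      by (simp add: norm_mult weight_nonneg mult_ac)
  qed (rule K(1))
qed

section \<open>Functions with slowly varying coefficients\<close>

text \<open>The quotient of the two sides is, up to \<open>c\<close>, the sequence in Euler's limit formula for
  \<open>\<Gamma>(\<beta>)\<close>; being convergent, it is bounded.\<close>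

lemma binomial_coeff_lower_bound:
  fixes \<beta> :: real
  assumes "\<beta> > 0"
  obtains c where "c > 0" "\<And>n. c * weight (\<beta> - 1) n \<le> pochhammer \<beta> n / fact n"
proof -
  have poch: "pochhammer \<beta> n > 0" for n
    using assms by (rule pochhammer_pos)
  let ?y = "\<lambda>n. weight (\<beta> - 1) n / (pochhammer \<beta> n / fact n)"
  have "\<forall>\<^sub>F n in sequentially. Gamma_series' \<beta> n = ?y n"
    using eventually_gt_at_top[of 0]
  proof eventually_elim
    case (elim n)
    have "exp (\<beta> * ln (real n)) = real n * real n powr (\<beta> - 1)"
    proof -
      have "exp (\<beta> * ln (real n)) = real n powr \<beta>"
        using elim by (simp add: powr_def)
      also have "\<dots> = real n * real n powr (\<beta> - 1)"
        using powr_mult_base[of "real n" "\<beta> - 1"] by simp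
      finally show ?thesis .
    qed
    moreover have "fact n = real n * fact (n - 1)"
      using elim by (simp add: fact_reduce)
    ultimately show ?case
      using elim by (simp add: Gamma_series'_def weight_def)
  qed
  then have "?y \<longlonglongrightarrow> Gamma \<beta>"
    using Gamma_series'_LIMSEQ by (rule Lim_transform_eventually[rotated])
  then have "Bseq ?y"
    by (intro convergent_imp_Bseq) (auto simp: convergent_def)
  then obtain K where K: "K > 0" "\<And>n. norm (?y n) \<le> K"
    by (auto elim: BseqE)
  show ?thesis
  proof (rule that)
    show "1 / K > 0" using K by simp
    fix n
    have "?y n \<le> K"
      using K(2)[of n] unfolding real_norm_def by (rule abs_le_D1)
    then show "1 / K * weight (\<beta> - 1) n \<le> pochhammer \<beta> n / fact n"
      using K(1) poch[of n] by (simp add: field_simps)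
  qed
qed

lemma binomial_series_sums:
  fixes \<beta> :: real
  assumes "cmod z < 1"
  shows "(\<lambda>n. of_real (pochhammer \<beta> n / fact n) * z ^ n) sums ((1 - z) powr of_real (- \<beta>))"
proof -
  have "(\<lambda>n. (of_real (- \<beta>) gchoose n) * (- z) ^ n) sums ((1 + (- z)) powr of_real (- \<beta>))"
    using assms by (intro gen_binomial_complex) simp
  moreover have "(of_real (- \<beta>) gchoose n) * (- z) ^ n = of_real (pochhammer \<beta> n / fact n) * z ^ n" for n
  proof -
    have "pochhammer (complex_of_real \<beta>) n = of_real (pochhammer \<beta> n)"
      by (simp add: pochhammer_of_real)
    moreover have "(- 1) ^ n * (- z) ^ n = z ^ n"
      by (simp flip: power_mult_distrib)
    ultimately show ?thesis
      by (simp add: gbinomial_pochhammer mult_ac)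
  qed
  ultimately show ?thesis by simp
qed

context
  fixes \<beta> :: real and r :: "nat \<Rightarrow> real"
  assumes \<beta>: "\<beta> > 0" and r: "\<And>k. 0 \<le> r k" "\<And>k. r k < 1"
begin

text \<open>A superposition of dilates of \<open>(1 - z)\<close> to the power \<open>-\<beta>\<close>, each bounded on the disk. The faster
  \<open>r\<^sub>k\<close> tends to \<open>1\<close>, the more slowly the coefficients fall behind those of that function.\<close>

definition spread_kernel :: "complex \<Rightarrow> complex" where
  "spread_kernel z = (\<Sum>k. (1 / 2) ^ Suc k * (1 - of_real (r k) * z) powr of_real (- \<beta>))"

definition spread_coeff :: "nat \<Rightarrow> real" where
  "spread_coeff n = pochhammer \<beta> n / fact n * (\<Sum>k. (1 / 2) ^ Suc k * r k ^ n)"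

lemma summable_spread: "summable (\<lambda>k. (1 / 2) ^ Suc k * r k ^ n)"
proof (rule summable_comparison_test')
  show "summable (\<lambda>k. (1 / 2 :: real) ^ Suc k)"
    by (rule sums_summable[OF power_half_series])
  show "norm ((1 / 2) ^ Suc k * r k ^ n) \<le> (1 / 2) ^ Suc k" if "k \<ge> 0" for k
  proof -
    have "r k ^ n \<le> 1" using r[of k] by (intro power_le_one) auto
    then show ?thesis using r(1)[of k] by (simp add: abs_mult mult_left_le)
  qed
qed

text \<open>All terms are nonnegative, so a single one bounds the sum from below.\<close>

lemma spread_coeff_ge: "pochhammer \<beta> n / fact n * ((1 / 2) ^ Suc k * r k ^ n) \<le> spread_coeff n"
  unfolding spread_coeff_def
proof (rule mult_left_mono)
  have "(\<Sum>j\<in>{k}. (1 / 2) ^ Suc j * r j ^ n) \<le> (\<Sum>j. (1 / 2) ^ Suc j * r j ^ n)"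
    by (intro sum_le_suminf summable_spread) (auto simp: r)
  then show "(1 / 2) ^ Suc k * r k ^ n \<le> (\<Sum>j. (1 / 2) ^ Suc j * r j ^ n)" by simp
qed (use \<beta> in \<open>simp add: pochhammer_nonneg\<close>)

text \<open>Both \<open>1 - \<rho>\<close> and \<open>|1 - \<rho> z|\<close> control \<open>|1 - z|\<close>, and the former is at most the latter. This makes
  the singularities of all dilates comparable with the one at \<open>1\<close>.\<close>

lemma cmod_one_minus_le: "cmod z \<le> 1 \<Longrightarrow> 0 \<le> \<rho> \<Longrightarrow> \<rho> \<le> 1 \<Longrightarrow> cmod (1 - z) \<le> 2 * cmod (1 - of_real \<rho> * z)"
proof -
  assume z: "cmod z \<le> 1" "0 \<le> \<rho>" "\<rho> \<le> 1"
  have 1: "cmod (of_real \<rho> * z) \<le> \<rho>"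
    using z by (simp add: norm_mult mult_left_le)
  have 2: "1 - \<rho> \<le> cmod (1 - of_real \<rho> * z)"
    using norm_triangle_ineq2[of 1 "of_real \<rho> * z"] 1 by simp
  have "cmod (1 - z) = cmod ((1 - of_real \<rho> * z) - of_real (1 - \<rho>) * z)"
    by (simp add: algebra_simps)
  also have "\<dots> \<le> cmod (1 - of_real \<rho> * z) + cmod (of_real (1 - \<rho>) * z)"
    by (rule norm_triangle_ineq4)
  also have "cmod (of_real (1 - \<rho>) * z) \<le> 1 - \<rho>"
    using z unfolding norm_mult norm_of_real by (simp add: mult_left_le)
  finally show ?thesis using 2 by linarith
qed

lemma Re_pos: "cmod z \<le> 1 \<Longrightarrow> 0 < Re (1 - of_real (r k) * z)"
proof -
  assume "cmod z \<le> 1"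
  then have "r k * cmod z \<le> r k * 1"
    using r by (intro mult_left_mono) auto
  then have "cmod (of_real (r k) * z) < 1"
    using r[of k] by (simp add: norm_mult)
  then have "\<bar>Re (of_real (r k) * z)\<bar> < 1"
    using abs_Re_le_cmod le_less_trans by blast
  then show ?thesis by simp
qed

text \<open>The kernel freed of its singularity at \<open>1\<close>.\<close>

definition spread_factor :: "complex \<Rightarrow> complex" where
  "spread_factor z = (\<Sum>k. (1 / 2) ^ Suc k *
     (of_real (cmod (1 - z) powr \<beta>) * (1 - of_real (r k) * z) powr of_real (- \<beta>)))"

lemma norm_spread_term:
  assumes z: "cmod z \<le> 1"
  shows "cmod ((1 / 2) ^ Suc k * (of_real (cmod (1 - z) powr \<beta>) * (1 - of_real (r k) * z) powr of_real (- \<beta>)))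
    \<le> 2 powr \<beta> * (1 / 2) ^ Suc k"
proof -
  let ?w = "1 - of_real (r k) * z"
  have w: "cmod ?w > 0"
    using Re_pos[OF z, of k] by (auto simp: complex_eq_iff)
  have "cmod (1 - z) powr \<beta> \<le> (2 * cmod ?w) powr \<beta>"
    using cmod_one_minus_le[OF z, of "r k"] r[of k] \<beta> by (intro powr_mono2) auto
  then have "cmod (1 - z) powr \<beta> * cmod ?w powr (- \<beta>) \<le> 2 powr \<beta> * cmod ?w powr \<beta> * cmod ?w powr (- \<beta>)"
    by (intro mult_right_mono) (auto simp: powr_mult)
  also have "\<dots> = 2 powr \<beta>"
    using w by (simp add: powr_minus)
  finally have "(1 / 2) ^ Suc k * (cmod (1 - z) powr \<beta> * cmod ?w powr (- \<beta>)) \<le> (1 / 2) ^ Suc k * 2 powr \<beta>"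
    by (intro mult_left_mono) auto
  then show ?thesis
    by (simp add: norm_mult norm_power norm_divide norm_powr_real_powr' mult.commute)
qed

lemma summable_half: "summable (\<lambda>k. K * (1 / 2 :: real) ^ Suc k)"
  by (intro summable_mult sums_summable[OF power_half_series])

text \<open>Each term is continuous on the closed disk, including the point \<open>1\<close>, because \<open>r\<^sub>k < 1\<close>; the
  uniform bound on the terms gives uniform convergence. The value at \<open>1\<close> is \<open>0\<close>, which is the
  source of the little-o condition.\<close>

lemma continuous_on_spread_factor: "continuous_on (cball 0 1) spread_factor"
proof -
  let ?t = "\<lambda>k z::complex. (1 / 2) ^ Suc k * (of_real (cmod (1 - z) powr \<beta>) * (1 - of_real (r k) * z) powr of_real (- \<beta>))"
  have lim: "uniform_limit (cball 0 1) (\<lambda>n z. \<Sum>k<n. ?t k z) (\<lambda>z. \<Sum>k. ?t k z) sequentially"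
    by (rule Weierstrass_m_test[OF _ summable_half[of "2 powr \<beta>"]]) (use norm_spread_term in auto)
  have "continuous_on (cball 0 1) (\<lambda>z::complex. (1 - of_real (r k) * z) powr of_real (- \<beta>))" for k
  proof (rule continuous_on_powr_complex)
    show "cball 0 1 \<subseteq> {z::complex. 0 \<le> Re (1 - of_real (r k) * z) \<or> Im (1 - of_real (r k) * z) \<noteq> 0}"
      using Re_pos[of _ k] by (auto intro: less_imp_le)
    show "0 < Re (complex_of_real (- \<beta>))" if "z \<in> cball 0 1" "1 - of_real (r k) * z = 0" for z :: complex
      using Re_pos[of z k] that by simp
  qed (intro continuous_intros)+
  moreover have "continuous_on (cball 0 1) (\<lambda>z::complex. cmod (1 - z) powr \<beta>)"
    using \<beta> by (intro continuous_on_powr' continuous_intros) auto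
  ultimately have "continuous_on (cball 0 1) (\<lambda>z. \<Sum>k<n. ?t k z)" for n
    by (intro continuous_on_sum continuous_on_mult continuous_on_const continuous_on_of_real)
  then have "continuous_on (cball 0 1) (\<lambda>z. \<Sum>k. ?t k z)"
    by (intro uniform_limit_theorem[OF _ lim] always_eventually allI) simp_all
  then show ?thesis
    by (simp add: spread_factor_def[abs_def])
qed

lemma spread_factor_one: "spread_factor 1 = 0"
  by (simp add: spread_factor_def)

lemma norm_spread_factor: "cmod z \<le> 1 \<Longrightarrow> cmod (spread_factor z) \<le> 2 powr \<beta>"
proof -
  assume z: "cmod z \<le> 1"
  have "(\<lambda>k. 2 powr \<beta> * (1 / 2 :: real) ^ Suc k) sums (2 powr \<beta> * 1)"
    by (intro sums_mult power_half_series)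
  then have "2 powr \<beta> = (\<Sum>k. 2 powr \<beta> * (1 / 2 :: real) ^ Suc k)"
    by (simp add: sums_iff)
  then show ?thesis
    unfolding spread_factor_def
    using norm_suminf_le[OF norm_spread_term[OF z] summable_half] by simp
qed

lemma spread_kernel_eq:
  assumes z: "cmod z \<le> 1" "z \<noteq> 1"
  shows "spread_kernel z = spread_factor z / of_real (cmod (1 - z) powr \<beta>)"
proof -
  let ?c = "complex_of_real (cmod (1 - z) powr \<beta>)"
  let ?t = "\<lambda>k. (1 / 2) ^ Suc k * (?c * (1 - of_real (r k) * z) powr of_real (- \<beta>))"
  have "summable ?t"
    by (rule summable_comparison_test'[OF summable_half norm_spread_term[OF z(1)]])
  then have "(\<Sum>k. ?t k / ?c) = spread_factor z / ?c"
    unfolding spread_factor_def by (rule suminf_divide)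
  moreover have "spread_kernel z = (\<Sum>k. ?t k / ?c)"
    unfolding spread_kernel_def using z by (intro suminf_cong) simp
  ultimately show ?thesis
    by (rule trans[rotated])
qed

text \<open>For finitely many dilates the expansion is the binomial series. Dropping the terms from the
  \<open>K\<close>-th on changes the \<open>n\<close>-th coefficient by at most \<open>2\<^sup>-\<^sup>K\<close> times the binomial coefficient, so the
  power series differ by at most \<open>2\<^sup>-\<^sup>K\<close> times an absolutely convergent series.\<close>

lemma spread_kernel_sums:
  assumes z: "cmod z < 1"
  shows "(\<lambda>n. of_real (spread_coeff n) * z ^ n) sums spread_kernel z"
proof -
  define b where "b n = pochhammer \<beta> n / fact n" for n
  have b0: "b n \<ge> 0" for n
    using \<beta> by (simp add: b_def pochhammer_nonneg)
  have "(\<lambda>n. of_real (b n) * of_real (cmod z) ^ n :: complex) sums ((1 - of_real (cmod z)) powr of_real (- \<beta>))"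
    unfolding b_def using z by (intro binomial_series_sums) simp
  then have "summable (\<lambda>n. complex_of_real (b n) * of_real (cmod z) ^ n)"
    by (rule sums_summable)
  then have "summable (\<lambda>n. complex_of_real (b n * cmod z ^ n))"
    by (simp only: of_real_mult of_real_power)
  then have bz: "summable (\<lambda>n. b n * cmod z ^ n)"
    by (simp only: summable_of_real_iff)
  define d where "d n = (\<Sum>k. (1 / 2) ^ Suc k * r k ^ n)" for n
  define dK where "dK K n = (\<Sum>k<K. (1 / 2) ^ Suc k * r k ^ n)" for K n
  have tail: "\<bar>d n - dK K n\<bar> \<le> (1 / 2) ^ K" for K n
  proof -
    have "d n - dK K n = (\<Sum>k. (1 / 2) ^ Suc (k + K) * r (k + K) ^ n)"
      unfolding d_def dK_def by (rule suminf_minus_initial_segment[OF summable_spread, symmetric])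
    also have "norm \<dots> \<le> (\<Sum>k. (1 / 2) ^ K * (1 / 2) ^ Suc k)"
    proof (rule norm_suminf_le[OF _ summable_half])
      show "norm ((1 / 2) ^ Suc (k + K) * r (k + K) ^ n) \<le> (1 / 2) ^ K * (1 / 2) ^ Suc k" for k
        using r[of "k + K"] by (simp add: abs_mult power_add mult_left_le power_le_one)
    qed
    also have "\<dots> = (1 / 2) ^ K"
      using sums_mult[OF power_half_series, of "(1 / 2) ^ K"] by (simp add: sums_iff)
    finally show ?thesis by simp
  qed
  have d01: "\<bar>d n\<bar> \<le> 1" for n
    using tail[of n 0] by (simp add: dK_def)
  have sm: "summable (\<lambda>n. of_real (b n * d n) * z ^ n)"
  proof (rule summable_comparison_test'[OF bz])
    show "norm (of_real (b n * d n) * z ^ n) \<le> b n * cmod z ^ n" for n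
    proof -
      have "norm (of_real (b n * d n) * z ^ n) = b n * \<bar>d n\<bar> * cmod z ^ n"
        unfolding norm_mult norm_of_real abs_mult norm_power using b0[of n] by simp
      also have "\<dots> \<le> b n * 1 * cmod z ^ n"
        by (intro mult_right_mono mult_left_mono d01 b0) auto
      finally show ?thesis by simp
    qed
  qed
  have smK: "(\<lambda>n. of_real (b n * dK K n) * z ^ n) sums
      (\<Sum>k<K. (1 / 2) ^ Suc k * (1 - of_real (r k) * z) powr of_real (- \<beta>))" for K
  proof -
    have "(\<lambda>n. \<Sum>k<K. (1 / 2) ^ Suc k * (of_real (b n) * (of_real (r k) * z) ^ n)) sums
        (\<Sum>k<K. (1 / 2) ^ Suc k * (1 - of_real (r k) * z) powr of_real (- \<beta>))"
    proof (intro sums_sum sums_mult)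
      fix k
      have "r k * cmod z \<le> 1 * cmod z" using r[of k] by (intro mult_right_mono) auto
      then have "cmod (of_real (r k) * z) < 1"
        using z r[of k] by (simp add: norm_mult)
      then show "(\<lambda>n. of_real (b n) * (of_real (r k) * z) ^ n) sums ((1 - of_real (r k) * z) powr of_real (- \<beta>))"
        unfolding b_def by (rule binomial_series_sums)
    qed
    moreover have "(\<Sum>k<K. (1 / 2) ^ Suc k * (of_real (b n) * (of_real (r k) * z) ^ n)) =
        of_real (b n * dK K n) * z ^ n" for n
      by (simp add: dK_def sum_distrib_left sum_distrib_right power_mult_distrib mult_ac)
    ultimately show ?thesis by simp
  qed
  define A where "A = (\<Sum>n. b n * cmod z ^ n)"
  define S where "S = (\<Sum>n. of_real (b n * d n) * z ^ n)"
  define SK where "SK K = (\<Sum>k<K. (1 / 2) ^ Suc k * (1 - of_real (r k) * z) powr of_real (- \<beta>))" for K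
  have diff: "cmod (SK K - S) \<le> A * (1 / 2) ^ K" for K
  proof -
    have SK_eq: "SK K = (\<Sum>n. of_real (b n * dK K n) * z ^ n)"
      unfolding SK_def by (rule sums_unique[OF smK])
    have "S - SK K = (\<Sum>n. of_real (b n * d n) * z ^ n - of_real (b n * dK K n) * z ^ n)"
      unfolding S_def SK_eq by (rule suminf_diff[OF sm sums_summable[OF smK]])
    then have "cmod (S - SK K) = cmod (\<Sum>n. of_real (b n * d n) * z ^ n - of_real (b n * dK K n) * z ^ n)"
      by (simp only:)
    also have "\<dots> \<le> (\<Sum>n. b n * cmod z ^ n * (1 / 2) ^ K)"
    proof (rule norm_suminf_le)
      show "summable (\<lambda>n. b n * cmod z ^ n * (1 / 2) ^ K)"
        by (intro summable_mult2 bz)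
      fix n
      have "of_real (b n * d n) * z ^ n - of_real (b n * dK K n) * z ^ n = of_real (b n * (d n - dK K n)) * z ^ n"
        by (simp add: algebra_simps)
      also have "cmod \<dots> = b n * cmod z ^ n * \<bar>d n - dK K n\<bar>"
        unfolding norm_mult norm_of_real abs_mult norm_power using b0[of n] by simp
      also have "\<dots> \<le> b n * cmod z ^ n * (1 / 2) ^ K"
        using b0[of n] by (intro mult_left_mono tail) auto
      finally show "cmod (of_real (b n * d n) * z ^ n - of_real (b n * dK K n) * z ^ n) \<le> b n * cmod z ^ n * (1 / 2) ^ K" .
    qed
    also have "\<dots> = A * (1 / 2) ^ K"
      unfolding A_def by (rule suminf_mult2[OF bz, symmetric])
    finally show ?thesis by (simp add: norm_minus_commute)
  qed
  have "(\<lambda>K. A * (1 / 2) ^ K) \<longlonglongrightarrow> A * 0"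
    by (rule tendsto_mult[OF tendsto_const LIMSEQ_realpow_zero]) auto
  then have lim0: "(\<lambda>K. A * (1 / 2) ^ K) \<longlonglongrightarrow> 0"
    by (simp only: mult_zero_right)
  have "(\<lambda>K. SK K - S) \<longlonglongrightarrow> 0"
    by (rule Lim_null_comparison[OF always_eventually[OF allI[OF diff]] lim0])
  then have "SK \<longlonglongrightarrow> S"
    by (rule LIM_zero_cancel)
  then have "(\<lambda>k. (1 / 2) ^ Suc k * (1 - of_real (r k) * z) powr of_real (- \<beta>)) sums S"
    unfolding sums_def SK_def .
  then have "spread_kernel z = S"
    unfolding spread_kernel_def by (rule sums_unique[symmetric])
  then show ?thesis
    using summable_sums[OF sm] unfolding S_def spread_coeff_def b_def d_def by simp
qed

end

section \<open>The test functions lie in the weak Hardy space\<close>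

lemma log_plus_mono: "0 \<le> x \<Longrightarrow> x \<le> y \<Longrightarrow> log_plus x \<le> log_plus y"
  by (simp add: log_plus_eq)

lemma near_one_set_measurable: "{\<zeta> \<in> sphere 0 1. cmod (1 - \<zeta>) < \<rho>} \<in> sets circle_measure"
proof -
  have "open {\<zeta>::complex. cmod (1 - \<zeta>) < \<rho>}"
    by (intro open_Collect_less continuous_intros)
  then have "sphere 0 1 \<inter> {\<zeta>. cmod (1 - \<zeta>) < \<rho>} \<in> sets circle_measure"
    by (intro borel_sets_circle) auto
  then show ?thesis
    by (simp add: Int_def)
qed

lemma AE_circle_neq_one: "AE \<zeta> in circle_measure. \<zeta> \<noteq> 1"
proof (rule AE_I')
  have set: "{1} \<in> sets circle_measure"
    by (intro borel_sets_circle) auto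
  have "measure circle_measure {1} \<le> 0 + \<rho>" if "\<rho> > 0" for \<rho>
  proof -
    have "measure circle_measure {1} \<le> measure circle_measure {\<zeta> \<in> sphere 0 1. cmod (1 - \<zeta>) < \<rho>}"
      using that by (intro circle.finite_measure_mono near_one_set_measurable) auto
    then show ?thesis
      using measure_circle_near_one[of \<rho>] that by linarith
  qed
  then have "measure circle_measure {1} \<le> 0"
    by (rule field_le_epsilon)
  then have "measure circle_measure {1} = 0"
    by (simp add: measure_le_0_iff)
  then show "{1} \<in> null_sets circle_measure"
    using set by (simp add: null_sets_def circle.emeasure_eq_measure)
qed auto

text \<open>The inverse square root of the distance to \<open>1\<close> is in weak \<open>L\<^sup>2\<close>, hence integrable.\<close>

lemma inverse_sqrt_integrable_circle:
  "(\<integral>\<^sup>+\<zeta>. ennreal (K * cmod (1 - \<zeta>) powr (- 1 / 2)) \<partial>circle_measure) < \<infinity>"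
proof -
  let ?h = "\<lambda>\<zeta>. cmod (1 - \<zeta>) powr (- 1 / 2)"
  have [measurable]: "(\<lambda>\<zeta>. cmod (1 - \<zeta>)) \<in> borel_measurable circle_measure"
    by (intro continuous_on_measurable_circle continuous_intros)
  have hm: "?h \<in> borel_measurable circle_measure"
    by measurable
  have weak: "emeasure circle_measure {\<zeta> \<in> space circle_measure. t < ?h \<zeta>} \<le> ennreal (1 / t\<^sup>2)" if t: "t > 1" for t
  proof -
    have "cmod (1 - \<zeta>) < 1 / t\<^sup>2" if th: "t < ?h \<zeta>" for \<zeta>
    proof -
      have "t\<^sup>2 < (?h \<zeta>)\<^sup>2"
        using th t by (intro power_strict_mono) auto
      also have "\<dots> = cmod (1 - \<zeta>) powr (- 1)"
        by (simp add: power2_eq_square powr_add[symmetric])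
      finally have "t\<^sup>2 < 1 / cmod (1 - \<zeta>)"
        by (simp add: powr_minus_divide)
      moreover have "cmod (1 - \<zeta>) > 0"
        using th t by (cases "\<zeta> = 1") auto
      ultimately show ?thesis
        using t by (simp add: field_simps)
    qed
    then have "emeasure circle_measure {\<zeta> \<in> space circle_measure. t < ?h \<zeta>} \<le>
        emeasure circle_measure {\<zeta> \<in> sphere 0 1. cmod (1 - \<zeta>) < 1 / t\<^sup>2}"
      by (intro emeasure_mono near_one_set_measurable) auto
    also have "\<dots> \<le> ennreal (1 / t\<^sup>2)"
      using measure_circle_near_one[of "1 / t\<^sup>2"] t by (simp add: circle.emeasure_eq_measure ennreal_leI)
    finally show ?thesis .
  qed
  have "(\<integral>\<^sup>+\<zeta>. ennreal (?h \<zeta>) \<partial>circle_measure) \<le> (\<integral>\<^sup>+\<zeta>. 1 + ennreal (max 0 (?h \<zeta> - 1)) \<partial>circle_measure)"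
  proof (rule nn_integral_mono)
    fix \<zeta>
    have "ennreal (?h \<zeta>) \<le> ennreal (1 + max 0 (?h \<zeta> - 1))"
      by (intro ennreal_leI) simp
    then show "ennreal (?h \<zeta>) \<le> 1 + ennreal (max 0 (?h \<zeta> - 1))"
      by (subst (asm) ennreal_plus) auto
  qed
  also have "\<dots> = 1 + (\<integral>\<^sup>+\<zeta>. ennreal (max 0 (?h \<zeta> - 1)) \<partial>circle_measure)"
    by (subst nn_integral_add) (auto simp: circle.emeasure_space_1 simp del: space_circle_measure)
  also have "\<dots> \<le> 1 + ennreal (1 / 1)"
    using weak by (intro add_left_mono nn_integral_excess_weak_L2 circle.sigma_finite_measure_axioms hm) auto
  also have "\<dots> < \<infinity>" by simp
  finally have fin: "(\<integral>\<^sup>+\<zeta>. ennreal (?h \<zeta>) \<partial>circle_measure) < \<infinity>" .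
  have "(\<integral>\<^sup>+\<zeta>. ennreal (K * ?h \<zeta>) \<partial>circle_measure) \<le> (\<integral>\<^sup>+\<zeta>. ennreal \<bar>K\<bar> * ennreal (?h \<zeta>) \<partial>circle_measure)"
    by (intro nn_integral_mono) (auto simp: ennreal_mult''[symmetric] intro!: ennreal_leI mult_right_mono)
  also have "\<dots> = ennreal \<bar>K\<bar> * (\<integral>\<^sup>+\<zeta>. ennreal (?h \<zeta>) \<partial>circle_measure)"
    using hm by (intro nn_integral_cmult) simp
  also have "\<dots> < \<infinity>"
    using fin by (simp add: ennreal_mult_less_top)
  finally show ?thesis .
qed

text \<open>From \<open>ln y = 2 ln (sqrt y) \<le> 2 sqrt y\<close> with \<open>y = 4 / x\<close>: logarithmic singularities are dominated
  by an integrable power.\<close>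

lemma log_plus_power_le:
  assumes "0 < x" "x \<le> 2" "\<beta> > 0"
  shows "log_plus ((4 / x) powr \<beta>) \<le> 4 * \<beta> * x powr (- 1 / 2)"
proof -
  have 1: "1 \<le> 4 / x" using assms by (simp add: field_simps)
  then have "1 \<le> (4 / x) powr \<beta>"
    using assms by (intro ge_one_powr_ge_zero) auto
  then have "log_plus ((4 / x) powr \<beta>) = \<beta> * ln (4 / x)"
    using 1 by (simp add: log_plus_eq ln_powr)
  also have "ln (4 / x) = 2 * ln ((4 / x) powr (1 / 2))"
    using 1 by (simp add: ln_powr)
  also have "\<dots> \<le> 2 * (4 / x) powr (1 / 2)"
    using assms by (intro mult_left_mono order.trans[OF ln_le_minus_one]) auto
  also have "(4 / x) powr (1 / 2) = 2 * x powr (- 1 / 2)"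
    using assms by (simp add: powr_divide powr_half_sqrt powr_minus_divide)
  finally show ?thesis
    using assms by simp
qed

text \<open>Away from \<open>1\<close> the function is continuous up to the circle, so its boundary function is the
  evident one, and dominated convergence with an inverse square root as majorant gives the Smirnov
  property. The boundary function exceeds \<open>t\<close> only where \<open>|1 - \<zeta>|\<close> to the power \<open>1/p\<close> is below
  \<open>|F(\<zeta>)| / t\<close>; for large \<open>t\<close> this forces \<open>\<zeta>\<close> close to \<open>1\<close>, where \<open>F\<close> is small.\<close>

lemma weak_hardy0I:
  assumes contF: "continuous_on (cball 0 1) F" and hol: "f holomorphic_on ball 0 1"
    and F1: "F 1 = 0" and Fbd: "\<And>z. cmod z \<le> 1 \<Longrightarrow> cmod (F z) \<le> 2 powr (1 / p)"
    and f: "\<And>z. cmod z \<le> 1 \<Longrightarrow> z \<noteq> 1 \<Longrightarrow> f z = F z / of_real (cmod (1 - z) powr (1 / p))"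
    and p: "p > 0"
  shows "f \<in> weak_hardy0 p"
proof -
  define \<beta> where "\<beta> = 1 / p"
  have \<beta>: "\<beta> > 0" and \<beta>p: "\<beta> * p = 1" "p * \<beta> = 1" using p by (auto simp: \<beta>_def)
  note Fbd = Fbd[folded \<beta>_def] and f = f[folded \<beta>_def]
  have contb: "continuous_on (ball 0 1) f"
    using hol by (rule holomorphic_on_imp_continuous_on)
  have nf: "cmod (f z) = cmod (F z) / cmod (1 - z) powr \<beta>" if "cmod z \<le> 1" "z \<noteq> 1" for z
    by (simp add: f[OF that] norm_divide)
  have contf: "continuous_on (cball 0 1 - {1}) f"
  proof -
    have "continuous_on (cball 0 1 - {1}) (\<lambda>z. F z / of_real (cmod (1 - z) powr \<beta>))"
      using \<beta> by (intro continuous_intros continuous_on_subset[OF contF] continuous_on_powr') auto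
    then show ?thesis
      by (rule continuous_on_eq) (auto simp: f)
  qed
  have nt: "has_nt_limit f \<zeta> (f \<zeta>)" if \<zeta>: "cmod \<zeta> = 1" "\<zeta> \<noteq> 1" for \<zeta>
    unfolding has_nt_limit_def
  proof (intro allI impI)
    fix c :: real
    have "(f \<longlongrightarrow> f \<zeta>) (at \<zeta> within cball 0 1 - {1})"
      using contf \<zeta> by (auto simp: continuous_on_def)
    then show "(f \<longlongrightarrow> f \<zeta>) (at \<zeta> within stolz_region c \<zeta>)"
      by (rule tendsto_within_subset) (auto simp: stolz_region_def)
  qed
  have bv: "nt_boundary f \<zeta> = f \<zeta>" if \<zeta>: "cmod \<zeta> = 1" "\<zeta> \<noteq> 1" for \<zeta>
    by (rule nt_boundary_eq[OF nt[OF that] \<zeta>(1)])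
  have bm: "nt_boundary f \<in> borel_measurable circle_measure"
    by (rule nt_boundary_measurable[OF contb])
  have radial_cont: "continuous_on (sphere 0 1) (\<lambda>\<zeta>. f (of_real r * \<zeta>))" if "0 < r" "r < 1" for r
    by (rule continuous_on_subset[OF continuous_on_radial[OF contb]]) (use that in auto)
  define D where "D \<zeta> = 4 * \<beta> * cmod (1 - \<zeta>) powr (- 1 / 2)" for \<zeta> :: complex
  have D_fin: "(\<integral>\<^sup>+\<zeta>. ennreal (D \<zeta>) \<partial>circle_measure) < \<infinity>"
    unfolding D_def by (rule inverse_sqrt_integrable_circle)
  have D_bound: "log_plus (cmod (f (of_real r * \<zeta>))) \<le> D \<zeta>"
    if r: "0 < r" "r < 1" and \<zeta>: "cmod \<zeta> = 1" "\<zeta> \<noteq> 1" for r \<zeta>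
  proof -
    let ?z = "of_real r * \<zeta>"
    have "cmod ?z = r"
      using r \<zeta> by (simp add: norm_mult)
    then have z: "cmod ?z \<le> 1" "?z \<noteq> 1"
      using r by (simp, metis norm_one less_irrefl)
    have x: "0 < cmod (1 - \<zeta>)" "cmod (1 - \<zeta>) \<le> 2"
      using \<zeta> norm_triangle_ineq4[of 1 \<zeta>] by auto
    have le: "cmod (1 - \<zeta>) \<le> 2 * cmod (1 - ?z)"
      using r \<zeta> by (intro cmod_one_minus_le) auto
    have "cmod (f ?z) \<le> 2 powr \<beta> / cmod (1 - ?z) powr \<beta>"
      unfolding nf[OF z] by (intro divide_right_mono Fbd z) auto
    also have "\<dots> = (2 / cmod (1 - ?z)) powr \<beta>"
      by (simp add: powr_divide)
    also have "\<dots> \<le> (4 / cmod (1 - \<zeta>)) powr \<beta>"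
      using le x \<beta> z by (intro powr_mono2) (auto simp: field_simps)
    finally have "log_plus (cmod (f ?z)) \<le> log_plus ((4 / cmod (1 - \<zeta>)) powr \<beta>)"
      by (intro log_plus_mono) auto
    also have "\<dots> \<le> D \<zeta>"
      unfolding D_def by (intro log_plus_power_le x \<beta>)
    finally show ?thesis .
  qed
  have smirnov: "f \<in> smirnov_class"
    unfolding smirnov_class_def nevanlinna_class_def
  proof (intro CollectI conjI hol)
    have "log_mean (\<lambda>\<zeta>. f (of_real r * \<zeta>)) \<le> (\<integral>\<^sup>+\<zeta>. ennreal (D \<zeta>) \<partial>circle_measure)" if r: "r \<in> {0<..<1}" for r
      unfolding log_mean_def
    proof (rule nn_integral_mono_AE)
      show "AE \<zeta> in circle_measure. ennreal (log_plus (cmod (f (of_real r * \<zeta>)))) \<le> ennreal (D \<zeta>)"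
        using AE_circle_neq_one AE_space
        by eventually_elim (use D_bound r in \<open>auto intro!: ennreal_leI\<close>)
    qed
    then have "(SUP r\<in>{0<..<1}. log_mean (\<lambda>\<zeta>. f (of_real r * \<zeta>))) \<le> (\<integral>\<^sup>+\<zeta>. ennreal (D \<zeta>) \<partial>circle_measure)"
      by (intro SUP_least) auto
    with D_fin show "(SUP r\<in>{0<..<1}. log_mean (\<lambda>\<zeta>. f (of_real r * \<zeta>))) < \<infinity>"
      by order
    show "((\<lambda>r. log_mean (\<lambda>\<zeta>. f (of_real r * \<zeta>))) \<longlongrightarrow> log_mean (nt_boundary f)) (at_left 1)"
    proof (rule tendsto_at_left_sequentially[of 0])
      fix S :: "nat \<Rightarrow> real" assume S: "\<And>n. S n < 1" "\<And>n. 0 < S n" "S \<longlonglongrightarrow> 1"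
      show "(\<lambda>n. log_mean (\<lambda>\<zeta>. f (of_real (S n) * \<zeta>))) \<longlonglongrightarrow> log_mean (nt_boundary f)"
        unfolding log_mean_def
      proof (rule nn_integral_dominated_convergence[where w = "\<lambda>\<zeta>. ennreal (D \<zeta>)"])
        have lm: "(\<lambda>z::complex. log_plus (cmod z)) \<in> borel_measurable borel"
          by (intro borel_measurable_continuous_onI continuous_intros)
        show "(\<lambda>\<zeta>. ennreal (log_plus (cmod (f (of_real (S n) * \<zeta>))))) \<in> borel_measurable circle_measure" for n
          using measurable_compose[OF continuous_on_measurable_circle[OF radial_cont[OF S(2) S(1)]] lm]
          by (rule measurable_compose) measurable
        show "(\<lambda>\<zeta>. ennreal (log_plus (cmod (nt_boundary f \<zeta>)))) \<in> borel_measurable circle_measure"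
          using measurable_compose[OF bm lm] by (rule measurable_compose) measurable
        have "(\<lambda>\<zeta>. cmod (1 - \<zeta>)) \<in> borel_measurable circle_measure"
          by (intro continuous_on_measurable_circle continuous_intros)
        then show "(\<lambda>\<zeta>. ennreal (D \<zeta>)) \<in> borel_measurable circle_measure"
          unfolding D_def by measurable
        show "AE \<zeta> in circle_measure. ennreal (log_plus (cmod (f (of_real (S n) * \<zeta>)))) \<le> ennreal (D \<zeta>)" for n
          using AE_circle_neq_one AE_space
          by eventually_elim (use D_bound S in \<open>auto intro!: ennreal_leI\<close>)
        show "AE \<zeta> in circle_measure. (\<lambda>n. ennreal (log_plus (cmod (f (of_real (S n) * \<zeta>)))))
            \<longlonglongrightarrow> ennreal (log_plus (cmod (nt_boundary f \<zeta>)))"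
          using AE_circle_neq_one AE_space
        proof eventually_elim
          case (elim \<zeta>)
          then have \<zeta>: "cmod \<zeta> = 1" "\<zeta> \<noteq> 1" by auto
          show ?case
            unfolding bv[OF \<zeta>]
            by (intro tendsto_ennrealI tendsto_log_plus has_nt_limit_radial[OF nt[OF \<zeta>] \<zeta>(1)] S)
        qed
      qed (rule D_fin)
    qed simp
  qed
  \<comment> \<open>A bound \<open>e\<close> for \<open>F\<close> on the set where the boundary function exceeds \<open>t\<close> confines that set to
    the arc of radius \<open>(e / t)\<^sup>p\<close> around \<open>1\<close>.\<close>
  have dist_le: "distribution_fn (nt_boundary f) t \<le> e powr p * t powr (- p)"
    if e: "e > 0" and t: "t > 0"
      and imp: "\<And>\<zeta>. cmod \<zeta> = 1 \<Longrightarrow> \<zeta> \<noteq> 1 \<Longrightarrow> t * cmod (1 - \<zeta>) powr \<beta> < cmod (F \<zeta>) \<Longrightarrow> cmod (F \<zeta>) \<le> e" for e t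
  proof -
    define \<rho> where "\<rho> = (e / t) powr p"
    have \<rho>: "\<rho> > 0" using e t by (simp add: \<rho>_def)
    have "cmod (1 - \<zeta>) < \<rho>" if \<zeta>: "cmod \<zeta> = 1" and th: "t < cmod (nt_boundary f \<zeta>)" for \<zeta>
    proof (cases "\<zeta> = 1")
      case True
      then show ?thesis using \<rho> by simp
    next
      case False
      have "t * cmod (1 - \<zeta>) powr \<beta> < cmod (F \<zeta>)"
        using th False \<zeta> by (simp add: bv nf field_simps)
      with imp[OF \<zeta> False] have "t * cmod (1 - \<zeta>) powr \<beta> < e" by fastforce
      then have "cmod (1 - \<zeta>) powr \<beta> < e / t"
        using t by (simp add: field_simps)
      then have "(cmod (1 - \<zeta>) powr \<beta>) powr p < (e / t) powr p"
        using p by (intro powr_less_mono2) auto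
      then show ?thesis
        by (simp add: powr_powr \<beta>p \<rho>_def)
    qed
    then have "distribution_fn (nt_boundary f) t \<le> measure circle_measure {\<zeta> \<in> sphere 0 1. cmod (1 - \<zeta>) < \<rho>}"
      unfolding distribution_fn_def
      by (intro circle.finite_measure_mono near_one_set_measurable) auto
    also have "\<dots> \<le> \<rho>"
      using \<rho> by (intro measure_circle_near_one) simp
    also have "\<rho> = e powr p * t powr (- p)"
      using e t by (simp add: \<rho>_def powr_divide powr_minus_divide)
    finally show ?thesis .
  qed
  \<comment> \<open>The same at the level \<open>t\<close> for which the measure of this arc is at most \<open>s\<close>.\<close>
  have R_le: "rearrangement (nt_boundary f) s * s powr \<beta> \<le> e"
    if e: "e > 0" and s: "s > 0"
      and imp: "\<And>\<zeta>. cmod \<zeta> = 1 \<Longrightarrow> \<zeta> \<noteq> 1 \<Longrightarrow> e * s powr (- \<beta>) * cmod (1 - \<zeta>) powr \<beta> < cmod (F \<zeta>) \<Longrightarrow> cmod (F \<zeta>) \<le> e" for e s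
  proof -
    let ?t = "e * s powr (- \<beta>)"
    have t: "?t > 0" using e s by simp
    have "distribution_fn (nt_boundary f) ?t \<le> e powr p * ?t powr (- p)"
      by (rule dist_le[OF e t imp])
    also have "?t powr (- p) = e powr (- p) * (s powr (- \<beta>)) powr (- p)"
      by (rule powr_mult)
    also have "(s powr (- \<beta>)) powr (- p) = s"
      using s by (simp only: powr_powr minus_mult_minus \<beta>p) simp
    also have "e powr p * (e powr (- p) * s) = s"
      using e by (simp add: powr_minus)
    finally have "rearrangement (nt_boundary f) s \<le> ?t"
      using t by (intro rearrangement_le) auto
    then have "rearrangement (nt_boundary f) s * s powr \<beta> \<le> ?t * s powr \<beta>"
      by (intro mult_right_mono) auto
    also have "\<dots> = e"
      using s by (simp add: powr_minus)
    finally show ?thesis .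
  qed
  show ?thesis
    unfolding weak_hardy0_def \<beta>_def[symmetric]
  proof (intro CollectI conjI smirnov)
    have "rearrangement (nt_boundary f) s * s powr \<beta> \<le> 2 powr \<beta>" if "s > 0" for s
      using that Fbd by (intro R_le) auto
    then show "bdd_above ((\<lambda>s. rearrangement (nt_boundary f) s * s powr \<beta>) ` {0<..})"
      by (intro bdd_aboveI2) auto
    show "((\<lambda>s. rearrangement (nt_boundary f) s * s powr \<beta>) \<longlongrightarrow> 0) (at_right 0)"
    proof (rule tendstoI)
      fix e :: real assume "e > 0"
      define e' where "e' = e / 2"
      have e': "e' > 0" using \<open>e > 0\<close> by (simp add: e'_def)
      obtain \<delta> where \<delta>: "\<delta> > 0" "\<And>z. z \<in> cball 0 1 \<Longrightarrow> dist z 1 < \<delta> \<Longrightarrow> dist (F z) (F 1) < e'"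
        using contF e' unfolding continuous_on_iff by (metis mem_cball_0 norm_one order_refl)
      \<comment> \<open>Below \<open>s0\<close> the crude bound for \<open>F\<close> already puts \<open>\<zeta>\<close> within \<open>\<delta>\<close> of \<open>1\<close>.\<close>
      define s0 where "s0 = (e' / 2 powr \<beta>) powr p * \<delta>"
      have s0: "s0 > 0" using e' \<delta> by (simp add: s0_def)
      have "rearrangement (nt_boundary f) s * s powr \<beta> \<le> e'" if s: "0 < s" "s < s0" for s
      proof (rule R_le[OF e' s(1)])
        fix \<zeta> assume \<zeta>: "cmod \<zeta> = 1" "\<zeta> \<noteq> 1" and lt: "e' * s powr (- \<beta>) * cmod (1 - \<zeta>) powr \<beta> < cmod (F \<zeta>)"
        have "e' * s powr (- \<beta>) * cmod (1 - \<zeta>) powr \<beta> < 2 powr \<beta>"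
          using lt Fbd[of \<zeta>] \<zeta> by simp
        then have "cmod (1 - \<zeta>) powr \<beta> < 2 powr \<beta> / e' * s powr \<beta>"
          using e' s by (simp add: powr_minus field_simps)
        then have "(cmod (1 - \<zeta>) powr \<beta>) powr p < (2 powr \<beta> / e' * s powr \<beta>) powr p"
          using p by (intro powr_less_mono2) auto
        also have "(cmod (1 - \<zeta>) powr \<beta>) powr p = cmod (1 - \<zeta>)"
          by (simp add: powr_powr \<beta>p)
        also have "(2 powr \<beta> / e' * s powr \<beta>) powr p = (2 powr \<beta> / e') powr p * s"
          unfolding powr_mult powr_powr \<beta>p using s by simp
        also have "\<dots> < (2 powr \<beta> / e') powr p * s0"
          using s e' by (intro mult_strict_left_mono) auto
        also have "\<dots> = \<delta>"
          using e' by (simp add: s0_def powr_divide)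
        finally have "dist (F \<zeta>) (F 1) < e'"
          using \<zeta> by (intro \<delta>(2)) (auto simp: dist_norm norm_minus_commute)
        then show "cmod (F \<zeta>) \<le> e'"
          by (simp add: F1)
      qed
      then have "dist (rearrangement (nt_boundary f) s * s powr \<beta>) 0 < e" if s: "0 < s" "s < s0" for s
        using rearrangement_nonneg[OF bm s(1)] s \<open>e > 0\<close> by (force simp: e'_def)
      then show "\<forall>\<^sub>F s in at_right 0. dist (rearrangement (nt_boundary f) s * s powr \<beta>) 0 < e"
        using s0 by (auto simp: eventually_at_right_field)
    qed
  qed
qed

text \<open>Choosing \<open>1 - r\<^sub>k = 1 / (2 (N\<^sub>k + 1))\<close> makes \<open>r\<^sub>k\<^sup>n\<close> at least \<open>1/2\<close> for all \<open>n \<le> N\<^sub>k\<close>, so that the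
  \<open>k\<close>-th dilate alone gives coefficients of the full order up to \<open>N\<^sub>k\<close>.\<close>

lemma weak_hardy0_prescribed_coeffs:
  fixes N :: "nat \<Rightarrow> nat"
  assumes p: "0 < p"
  obtains a c where "a \<in> coeff_seqs (weak_hardy0 p)" "c > 0"
    "\<And>k n. n \<le> N k \<Longrightarrow> c * (1 / 2) ^ k * weight (1 / p - 1) n \<le> cmod (a n)"
proof -
  define \<beta> where "\<beta> = 1 / p"
  have \<beta>: "\<beta> > 0" using p by (simp add: \<beta>_def)
  define r where "r k = 1 - 1 / (2 * (real (N k) + 1))" for k
  have r: "0 \<le> r k" "r k < 1" for k
    by (auto simp: r_def field_simps)
  have r_pow: "1 / 2 \<le> r k ^ n" if "n \<le> N k" for k n
  proof -
    have "real n / (2 * (real (N k) + 1)) \<le> 1 / 2"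
      using that by (simp add: field_simps)
    then have "1 / 2 \<le> 1 + real n * (- 1 / (2 * (real (N k) + 1)))"
      by simp
    also have "\<dots> \<le> (1 + (- 1 / (2 * (real (N k) + 1)))) ^ n"
      by (intro Bernoulli_inequality) (auto simp: field_simps)
    finally show ?thesis by (simp add: r_def)
  qed
  obtain c where c: "c > 0" "\<And>n. c * weight (\<beta> - 1) n \<le> pochhammer \<beta> n / fact n"
    using binomial_coeff_lower_bound[OF \<beta>] by blast
  define f where "f = spread_kernel \<beta> r"
  define a where "a n = complex_of_real (spread_coeff \<beta> r n)" for n
  have sums: "(\<lambda>n. a n * z ^ n) sums f z" if "z \<in> ball 0 1" for z
    unfolding a_def f_def using that by (intro spread_kernel_sums \<beta> r) simp
  have "f holomorphic_on ball 0 1"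
    by (rule power_series_holomorphic[where a = a]) (use sums in simp)
  then have "f \<in> weak_hardy0 p"
    using continuous_on_spread_factor[OF \<beta> r] spread_factor_one[OF \<beta> r] norm_spread_factor[OF \<beta> r]
      spread_kernel_eq[OF \<beta> r] p
    unfolding f_def \<beta>_def by (intro weak_hardy0I) auto
  then have "a \<in> coeff_seqs (weak_hardy0 p)"
    using sums unfolding coeff_seqs_def by blast
  moreover have "c / 4 * (1 / 2) ^ k * weight (1 / p - 1) n \<le> cmod (a n)" if "n \<le> N k" for k n
  proof -
    have "c / 4 * (1 / 2) ^ k * weight (1 / p - 1) n = c * weight (\<beta> - 1) n * ((1 / 2) ^ Suc k * (1 / 2))"
      by (simp add: \<beta>_def)
    also have "\<dots> \<le> pochhammer \<beta> n / fact n * ((1 / 2) ^ Suc k * r k ^ n)"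
      using c weight_nonneg r_pow[OF that] \<beta> by (intro mult_mono c) (auto simp: pochhammer_nonneg)
    also have "\<dots> \<le> spread_coeff \<beta> r n"
      by (rule spread_coeff_ge[OF \<beta> r])
    also have "\<dots> \<le> cmod (a n)"
      by (simp add: a_def)
    finally show ?thesis .
  qed
  ultimately show ?thesis
    using that[of a "c / 4"] c(1) by simp
qed

section \<open>The multiplier theorem\<close>

text \<open>If the weighted sequence \<open>x\<close> were not in \<open>\<ell>\<^sup>s\<close>, choose \<open>N\<^sub>k\<close> so large that \<open>x\<close> up to \<open>N\<^sub>k\<close> is large
  even after multiplication by \<open>2\<^sup>-\<^sup>k\<close>; the test sequence for these \<open>N\<^sub>k\<close> contradicts the multiplier
  property.\<close>

lemma multipliers_subset_weighted_ell:
  assumes p: "0 < p" and s: "0 < s"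
  shows "multipliers (coeff_seqs (weak_hardy0 p)) (ell s) \<subseteq> weighted (ell s) (1 / p - 1)"
proof (intro subsetI, rule ccontr)
  fix l assume l: "l \<in> multipliers (coeff_seqs (weak_hardy0 p)) (ell s)"
    and nl: "l \<notin> weighted (ell s) (1 / p - 1)"
  define x where "x n = weight (1 / p - 1) n * cmod (l n)" for n
  have x0: "x n \<ge> 0" for n
    by (simp add: x_def weight_nonneg)
  have nx: "(\<lambda>n. of_real (weight (1 / p - 1) n) * l n) \<notin> ell s"
    using nl by (simp add: weighted_def)
  have x_norm: "cmod (of_real (weight (1 / p - 1) n) * l n) = x n" for n
    by (simp add: x_def norm_mult weight_nonneg)
  have test: "\<exists>y\<in>ell s. \<exists>c>0. \<forall>k n. n \<le> N k \<longrightarrow> c * (1 / 2) ^ k * x n \<le> cmod (y n)" for N :: "nat \<Rightarrow> nat"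
  proof -
    obtain a c where a: "a \<in> coeff_seqs (weak_hardy0 p)" and c: "c > 0"
      and le: "\<And>k n. n \<le> N k \<Longrightarrow> c * (1 / 2) ^ k * weight (1 / p - 1) n \<le> cmod (a n)"
      by (rule weak_hardy0_prescribed_coeffs[OF p, of N]) (rule that)
    have "(\<lambda>n. l n * a n) \<in> ell s"
      using l a by (auto simp: multipliers_def)
    moreover have "c * (1 / 2) ^ k * x n \<le> cmod (l n * a n)" if "n \<le> N k" for k n
      using mult_right_mono[OF le[OF that], of "cmod (l n)"] by (simp add: x_def norm_mult mult_ac)
    ultimately show ?thesis
      using c by (intro bexI[of _ "\<lambda>n. l n * a n"] exI[of _ c] conjI allI impI)
  qed
  show False
  proof (cases "s = \<infinity>")
    case True
    have "\<exists>n. real k * 2 ^ k < x n" for k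
    proof (rule ccontr)
      assume "\<not> ?thesis"
      then have "cmod (of_real (weight (1 / p - 1) n) * l n) \<le> real k * 2 ^ k" for n
        unfolding x_norm by (meson not_le)
      then have "(\<lambda>n. of_real (weight (1 / p - 1) n) * l n) \<in> ell s"
        unfolding ell_def using True by (auto intro!: boundedI)
      with nx show False ..
    qed
    then obtain N where N: "\<And>k. real k * 2 ^ k < x (N k)" by metis
    obtain y c where y: "y \<in> ell s" and c: "c > 0"
      and "\<forall>k n. n \<le> N k \<longrightarrow> c * (1 / 2) ^ k * x n \<le> cmod (y n)"
      using test[of N] by (elim bexE exE conjE)
    then have le: "\<And>k n. n \<le> N k \<Longrightarrow> c * (1 / 2) ^ k * x n \<le> cmod (y n)"
      by simp
    obtain B where B: "\<And>n. cmod (y n) \<le> B"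
      using y True by (auto simp: ell_def bounded_iff)
    obtain k :: nat where "B / c < real k"
      using reals_Archimedean2[of "B / c"] by (elim exE)
    then have k: "B < c * real k"
      using c by (simp add: pos_divide_less_eq mult.commute)
    have "c * real k = c * (1 / 2) ^ k * (real k * 2 ^ k)"
      by (simp add: power_divide)
    also have "\<dots> \<le> c * (1 / 2) ^ k * x (N k)"
      using N[of k] c by (intro mult_left_mono) auto
    also have "\<dots> \<le> B"
      using le[of "N k" k] B[of "N k"] by simp
    finally show False using k by simp
  next
    case False
    define \<sigma> where "\<sigma> = enn2real s"
    have \<sigma>: "\<sigma> > 0"
      using s False by (simp add: \<sigma>_def enn2real_positive_iff less_top)
    have "\<not> summable (\<lambda>n. x n powr \<sigma>)"
      using nx False by (simp add: ell_def x_norm \<sigma>_def)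
    then have "\<exists>n. A < (\<Sum>i<n. x i powr \<sigma>)" for A
    proof (rule contrapos_np)
      assume "\<not> (\<exists>n. A < (\<Sum>i<n. x i powr \<sigma>))"
      then show "summable (\<lambda>n. x n powr \<sigma>)"
        by (intro summableI_nonneg_bounded[of _ A]) (auto simp: not_less)
    qed
    then have "\<forall>k. \<exists>n. real k * (2 ^ k) powr \<sigma> < (\<Sum>i<n. x i powr \<sigma>)"
      by (intro allI)
    from choice[OF this] obtain N where N: "\<And>k. real k * (2 ^ k) powr \<sigma> < (\<Sum>i<N k. x i powr \<sigma>)"
      by (elim exE) (rule that, elim allE)
    obtain y c where y: "y \<in> ell s" and c: "c > 0"
      and "\<forall>k n. n \<le> N k \<longrightarrow> c * (1 / 2) ^ k * x n \<le> cmod (y n)"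
      using test[of N] by (elim bexE exE conjE)
    then have le: "\<And>k n. n \<le> N k \<Longrightarrow> c * (1 / 2) ^ k * x n \<le> cmod (y n)"
      by simp
    have sy: "summable (\<lambda>n. cmod (y n) powr \<sigma>)"
      using y False by (simp add: ell_def \<sigma>_def)
    let ?T = "\<Sum>n. cmod (y n) powr \<sigma>"
    obtain k :: nat where "?T / c powr \<sigma> < real k"
      using reals_Archimedean2[of "?T / c powr \<sigma>"] by (elim exE)
    then have k: "?T < c powr \<sigma> * real k"
      using c by (simp add: pos_divide_less_eq mult.commute)
    have "(c * (1 / 2) ^ k) powr \<sigma> * (2 ^ k) powr \<sigma> = (c * (1 / 2) ^ k * 2 ^ k) powr \<sigma>"
      by (rule powr_mult[symmetric])
    also have "c * (1 / 2) ^ k * 2 ^ k = c"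
      by (simp add: power_divide)
    finally have "c powr \<sigma> * real k = (c * (1 / 2) ^ k) powr \<sigma> * (2 ^ k) powr \<sigma> * real k"
      by (rule arg_cong[of _ _ "\<lambda>u. u * real k", OF sym])
    also have "\<dots> = (c * (1 / 2) ^ k) powr \<sigma> * (real k * (2 ^ k) powr \<sigma>)"
      by simp
    also have "\<dots> \<le> (c * (1 / 2) ^ k) powr \<sigma> * (\<Sum>i<N k. x i powr \<sigma>)"
      using N[of k] by (intro mult_left_mono) auto
    also have "\<dots> = (\<Sum>i<N k. (c * (1 / 2) ^ k * x i) powr \<sigma>)"
      by (simp only: sum_distrib_left powr_mult)
    also have "\<dots> \<le> (\<Sum>i<N k. cmod (y i) powr \<sigma>)"
      using le c x0 \<sigma> by (intro sum_mono powr_mono2) auto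
    also have "\<dots> \<le> ?T"
      by (intro sum_le_suminf sy) auto
    finally show False using k by simp
  qed
qed

theorem theorem5p3:
  fixes p :: real and s :: ennreal
  assumes "0 < p" and "p < 1" and "0 < s"
  shows "multipliers (coeff_seqs (weak_hardy0 p)) (ell s) = weighted (ell s) (1 / p - 1)"
  using multipliers_subset_weighted_ell[OF assms(1,3)] weighted_ell_subset_multipliers[OF assms(1,2)]
  by blast

end
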